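(* Let $M\ge 4N-2$. For generic range $R_S$ the following holds: for every frame matrix $S\in\mathbb{C}^{M\times N}$ with range $R_S$ and every $\psi_0\in\mathbb{C}^N$ such that $a:=|S\psi_0|$ has all entries nonzero, there exists an open neighborhood $U$ of $S_a:=\{e^{it}S\psi_0:\ t\in[0,2\pi)\}$ such that $U\cap\Theta_{a,0}^{\mathrm{AP}}=S_a$, where $\Theta_{a,0}^{\mathrm{AP}}:=\{\zeta\in R_S:\ P_SP_a\zeta=\zeta\}$.
   Context: $M\ge N\ge 1$ are integers. A frame is a family $f_1,\dots,f_M\in\mathbb{C}^N$ spanning $\mathbb{C}^N$; its matrix $S\in\mathbb{C}^{M\times N}$ has $i$-th row $f_i^*$. $R_S\subset\mathbb{C}^M$ denotes the range (column space) of $S$, a complex $N$-dimensional subspace. For a vector $u$, $|u|$ is the vector of entrywise moduli. Phase correction operator: $P_S:=S(S^*S)^{-1}S^*$, the orthogonal projection of $\mathbb{C}^M$ onto $R_S$. Amplitude correction operator: for $a\in\mathbb{R}_+^M$ (nonnegative entries), $P_a:\mathbb{C}^M\to\mathbb{C}^M$ is defined entrywise by $(P_az)(i)=a(i)\,z(i)/|z(i)|$ if $z(i)\ne 0$ and $(P_az)(i)=a(i)$ if $z(i)=0$. "For generic $R_S$" means: there is a non-empty Zariski open set in the Grassmannian $\mathrm{Gr}(N,M;\mathbb{C})$ of complex $N$-dimensional subspaces of $\mathbb{C}^M$, regarded as a real algebraic variety, such that the statement holds for all frames whose range lies in this set. *)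

theory Defs
  imports "HOL-Analysis.Analysis"
begin

section \<open>Frames\<close>

text \<open>
  The spaces of complex vectors of length \<open>N\<close> and \<open>M\<close> are \<open>complex^'n\<close> and \<open>complex^'m\<close>, and an
  \<open>M \<times> N\<close> matrix has type \<open>complex^'n^'m\<close>. The complex scalar action is \<open>(*s)\<close>, so
  \<^const>\<open>vec.span\<close>, \<^const>\<open>vec.subspace\<close> and \<^const>\<open>vec.dim\<close> are the complex notions;
  the unqualified ones would be the real notions.
\<close>

definition is_frame :: "('m::finite \<Rightarrow> complex^'n::finite) \<Rightarrow> bool" where
  "is_frame f \<longleftrightarrow> vec.span (range f) = UNIV"

definition is_frame_matrix :: "complex^'n::finite^'m::finite \<Rightarrow> bool" where
  "is_frame_matrix S \<longleftrightarrow> (\<exists>f. is_frame f \<and> S = (\<chi> i j. cnj (f i $ j)))"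

definition ctranspose :: "complex^'n::finite^'m::finite \<Rightarrow> complex^'m^'n" where
  "ctranspose A = (\<chi> i j. cnj (A $ j $ i))"

definition phase_correction :: "complex^'n::finite^'m::finite \<Rightarrow> complex^'m^'m" where
  "phase_correction S = S ** matrix_inv (ctranspose S ** S) ** ctranspose S"

definition modulus :: "complex^'m::finite \<Rightarrow> real^'m" where
  "modulus z = (\<chi> i. cmod (z $ i))"

definition amplitude_correction :: "real^'m::finite \<Rightarrow> complex^'m \<Rightarrow> complex^'m" where
  "amplitude_correction a z =
     (\<chi> i. if z $ i \<noteq> 0 then of_real (a $ i) * z $ i / of_real (cmod (z $ i)) else of_real (a $ i))"

definition AP_fixed_points :: "complex^'n::finite^'m::finite \<Rightarrow> real^'m \<Rightarrow> (complex^'m) set" where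
  "AP_fixed_points S a =
     {\<zeta> \<in> range ((*v) S). phase_correction S *v amplitude_correction a \<zeta> = \<zeta>}"

definition phase_orbit :: "complex^'m::finite \<Rightarrow> (complex^'m) set" where
  "phase_orbit z = {exp (\<i> * of_real t) *s z | t. t \<in> {0..<2 * pi}}"


section \<open>The Grassmannian as a real algebraic variety\<close>

definition Grassmannian :: "nat \<Rightarrow> (complex^'m::finite) set set" where
  "Grassmannian N = {V. vec.subspace V \<and> vec.dim V = N}"

definition is_orthogonal_projector :: "complex^'m::finite^'m \<Rightarrow> (complex^'m) set \<Rightarrow> bool" where
  "is_orthogonal_projector P V \<longleftrightarrow>
     P ** P = P \<and> ctranspose P = P \<and> range ((*v) P) = V"

definition orthogonal_projector :: "(complex^'m::finite) set \<Rightarrow> complex^'m^'m" where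
  "orthogonal_projector V = (THE P. is_orthogonal_projector P V)"

text \<open>
  The structure of real affine algebraic variety on the Grassmannian is the usual one (Bochnak,
  Coste and Roy, Real Algebraic Geometry, Section 3.4): a subspace is identified with its
  orthogonal projector, so that the Grassmannian becomes the real algebraic set of Hermitian
  idempotent matrices of trace \<open>N\<close>. Zariski closed sets are the common zero sets of real
  polynomials in the real and imaginary parts of the matrix entries; these polynomials are
  exactly the \<^const>\<open>real_polynomial_function\<close>s on the real vector space \<open>complex^'m^'m\<close>.
\<close>

definition zariski_closed :: "nat \<Rightarrow> (complex^'m::finite) set set \<Rightarrow> bool" where
  "zariski_closed N Z \<longleftrightarrow>
     (\<exists>F :: (complex^'m^'m \<Rightarrow> real) set. (\<forall>p\<in>F. real_polynomial_function p) \<and>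
        Z = {V \<in> Grassmannian N. \<forall>p\<in>F. p (orthogonal_projector V) = 0})"

definition zariski_open :: "nat \<Rightarrow> (complex^'m::finite) set set \<Rightarrow> bool" where
  "zariski_open N \<U> \<longleftrightarrow> \<U> \<subseteq> Grassmannian N \<and> zariski_closed N (Grassmannian N - \<U>)"


section \<open>Consistency of the definitions\<close>

lemma ctranspose_mult:
  "ctranspose (A ** B) = ctranspose B ** ctranspose A"
  for A :: "complex^'n::finite^'m::finite" and B :: "complex^'k::finite^'n"
  by (simp add: ctranspose_def matrix_matrix_mult_def vec_eq_iff mult.commute)

lemma ctranspose_ctranspose [simp]: "ctranspose (ctranspose A) = A"
  by (simp add: ctranspose_def vec_eq_iff)

lemma is_orthogonal_projector_unique:
  assumes "is_orthogonal_projector P V" "is_orthogonal_projector Q V"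
  shows "P = Q"
proof -
  have fix_range: "A ** B = B"
    if "is_orthogonal_projector A V" "is_orthogonal_projector B V" for A B :: "complex^'a^'a"
  proof -
    have "(A ** B) *v x = B *v x" for x
    proof -
      have "B *v x \<in> range ((*v) A)"
        using that by (auto simp: is_orthogonal_projector_def)
      then obtain y where "B *v x = A *v y" by blast
      then show ?thesis
        using that(1) by (metis is_orthogonal_projector_def matrix_vector_mul_assoc)
    qed
    then show ?thesis by (simp add: matrix_eq)
  qed
  have "Q = ctranspose (P ** Q)"
    using fix_range[OF assms] assms(2) by (simp add: is_orthogonal_projector_def)
  also have "\<dots> = Q ** P"
    using assms by (simp add: ctranspose_mult is_orthogonal_projector_def)
  also have "\<dots> = P"
    using fix_range[OF assms(2,1)] .
  finally show ?thesis by simp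
qed

lemma orthogonal_projector_eqI:
  "is_orthogonal_projector P V \<Longrightarrow> orthogonal_projector V = P"
  unfolding orthogonal_projector_def
  by (rule the_equality) (auto dest: is_orthogonal_projector_unique)

lemma sum_cnj_mult_eq_0_iff:
  "(\<Sum>i\<in>UNIV. cnj (x $ i) * x $ i) = 0 \<longleftrightarrow> x = 0" for x :: "complex^'m::finite"
proof -
  have "(\<Sum>i\<in>UNIV. cnj (x $ i) * x $ i) = of_real (\<Sum>i\<in>UNIV. (cmod (x $ i))\<^sup>2)"
    unfolding of_real_sum complex_norm_square by (simp add: mult.commute)
  moreover have "(\<Sum>i\<in>UNIV. (cmod (x $ i))\<^sup>2) = 0 \<longleftrightarrow> x = 0"
    by (simp add: sum_nonneg_eq_0_iff vec_eq_iff)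
  ultimately show ?thesis by (simp only: of_real_eq_0_iff)
qed

lemma is_frame_matrix_injective:
  assumes "is_frame_matrix S" "S *v x = 0"
  shows "x = 0"
proof -
  obtain f where f: "is_frame f" "S = (\<chi> i j. cnj (f i $ j))"
    using assms(1) by (auto simp: is_frame_matrix_def)
  let ?W = "{v. (\<Sum>j\<in>UNIV. cnj (v $ j) * x $ j) = 0}"
  have "vec.subspace ?W"
    by (simp add: vec.subspace_def distrib_right sum.distrib mult.assoc flip: sum_distrib_left)
  moreover have "range f \<subseteq> ?W"
    using assms(2) by (auto simp: f(2) matrix_vector_mult_def vec_eq_iff)
  ultimately have "vec.span (range f) \<subseteq> ?W"
    by (rule vec.span_minimal[rotated])
  then have "x \<in> ?W"
    using f(1) by (auto simp: is_frame_def)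
  then show ?thesis by (simp add: sum_cnj_mult_eq_0_iff)
qed

lemma cinner_ctranspose:
  "(\<Sum>j\<in>UNIV. cnj (x $ j) * ((ctranspose S ** S) *v x) $ j)
     = (\<Sum>i\<in>UNIV. cnj ((S *v x) $ i) * (S *v x) $ i)"
  for S :: "complex^'n::finite^'m::finite"
proof -
  have "(\<Sum>j\<in>UNIV. cnj (x $ j) * (ctranspose S *v y) $ j)
          = (\<Sum>i\<in>UNIV. cnj ((S *v x) $ i) * y $ i)" for y
    by (simp add: ctranspose_def matrix_vector_mult_def sum_distrib_left sum_distrib_right ac_simps)
       (rule sum.swap)
  then show ?thesis by (simp flip: matrix_vector_mul_assoc)
qed

lemma invertible_gram:
  assumes "is_frame_matrix S"
  shows "invertible (ctranspose S ** S)"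
proof -
  have "x = 0" if "(ctranspose S ** S) *v x = 0" for x
  proof -
    have "S *v x = 0"
      using cinner_ctranspose[of x S] that by (simp add: sum_cnj_mult_eq_0_iff)
    then show ?thesis using is_frame_matrix_injective[OF assms] by blast
  qed
  then show ?thesis
    by (simp add: invertible_left_inverse matrix_left_invertible_ker)
qed

theorem orthogonal_projector_range_frame:
  assumes "is_frame_matrix S"
  shows "is_orthogonal_projector (phase_correction S) (range ((*v) S))"
    and "orthogonal_projector (range ((*v) S)) = phase_correction S"
proof -
  let ?G = "ctranspose S ** S" and ?P = "phase_correction S"
  let ?H = "matrix_inv ?G"
  have H: "?G ** ?H = mat 1" "?H ** ?G = mat 1"
    using invertible_gram[OF assms] unfolding invertible_def matrix_inv_def
    by (metis (mono_tags, lifting) someI_ex)+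
  have "ctranspose ?G = ?G" by (simp add: ctranspose_mult)
  moreover have one: "ctranspose (mat 1 :: complex^'a^'a) = mat 1"
    by (simp add: ctranspose_def mat_def vec_eq_iff)
  ultimately have "ctranspose ?H ** ?G = mat 1"
    using arg_cong[OF H(1), of ctranspose] by (simp add: ctranspose_mult)
  then have H_herm: "ctranspose ?H = ?H"
    by (metis H(1) matrix_mul_assoc matrix_mul_lid matrix_mul_rid)
  have PS: "?P ** S = S"
    using H(2) by (simp add: phase_correction_def flip: matrix_mul_assoc)
  have "?P ** ?P = (?P ** S) ** ?H ** ctranspose S"
    by (simp add: phase_correction_def matrix_mul_assoc)
  then have "?P ** ?P = ?P" by (simp add: PS) (simp add: phase_correction_def)
  moreover have "ctranspose ?P = ?P"
    by (simp add: phase_correction_def ctranspose_mult H_herm matrix_mul_assoc)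
  moreover have "range ((*v) ?P) = range ((*v) S)"
  proof
    show "range ((*v) ?P) \<subseteq> range ((*v) S)"
      by (auto simp: phase_correction_def simp flip: matrix_vector_mul_assoc)
    show "range ((*v) S) \<subseteq> range ((*v) ?P)"
      by (metis (no_types, lifting) PS image_subsetI matrix_vector_mul_assoc rangeI)
  qed
  ultimately show "is_orthogonal_projector ?P (range ((*v) S))"
    by (simp add: is_orthogonal_projector_def)
  then show "orthogonal_projector (range ((*v) S)) = ?P"
    by (rule orthogonal_projector_eqI)
qed

theorem Grassmannian_iff_range_frame:
  fixes V :: "(complex^'m::finite) set"
  shows "V \<in> Grassmannian CARD('n::finite) \<longleftrightarrow>
         (\<exists>S :: complex^'n^'m. is_frame_matrix S \<and> V = range ((*v) S))"
proof
  assume "\<exists>S :: complex^'n^'m. is_frame_matrix S \<and> V = range ((*v) S)"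
  then obtain S :: "complex^'n^'m" where S: "is_frame_matrix S" "V = range ((*v) S)" by blast
  have "inj ((*v) S)"
    using is_frame_matrix_injective[OF S(1)] by (simp add: vec.inj_iff_eq_0)
  then have "vec.dim V = vec.dim (UNIV :: (complex^'n) set)"
    unfolding S(2) by (intro vec.dim_image_eq) (auto simp: inj_on_def)
  moreover have "vec.subspace V"
    unfolding S(2) by (intro vec.subspace_image) auto
  ultimately show "V \<in> Grassmannian CARD('n)"
    by (simp add: Grassmannian_def card_cart_basis)
next
  assume "V \<in> Grassmannian CARD('n)"
  then have V: "vec.subspace V" "vec.dim V = CARD('n)" by (auto simp: Grassmannian_def)
  obtain B where B: "B \<subseteq> V" "vec.independent B" "V \<subseteq> vec.span B" "card B = CARD('n)"
    using vec.basis_exists[of V] V(2) by metis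
  have "finite B" using B(2) by (rule vec.finiteI_independent)
  then obtain b where b: "bij_betw b (UNIV :: 'n set) B"
    using B(4) by (metis finite_same_card_bij finite_class.finite_UNIV)
  define S :: "complex^'n^'m" where "S = (\<chi> i j. b j $ i)"
  have S_apply: "S *v x = (\<Sum>j\<in>UNIV. x $ j *s b j)" for x
    by (simp add: S_def matrix_vector_mult_def vec_eq_iff mult.commute)
  have "vec.span B = V"
    using B V(1) by (metis vec.span_minimal subset_antisym)
  have range_S: "range ((*v) S) = V"
  proof
    show "range ((*v) S) \<subseteq> V"
      using b B(1) V(1) by (auto simp: S_apply bij_betw_def intro!: vec.subspace_sum vec.subspace_scale)
    have "B \<subseteq> range ((*v) S)"
    proof
      fix v assume "v \<in> B"
      then obtain k where "v = b k" using b by (auto simp: bij_betw_def)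
      also have "b k = S *v axis k 1"
        by (simp add: S_def matrix_vector_mult_def vec_eq_iff axis_def if_distrib cong: if_cong)
      finally show "v \<in> range ((*v) S)" by blast
    qed
    moreover have "vec.subspace (range ((*v) S))"
      by (intro vec.subspace_image) auto
    ultimately show "V \<subseteq> range ((*v) S)"
      using \<open>vec.span B = V\<close> by (metis vec.span_minimal)
  qed
  have "x = 0" if "S *v x = 0" for x
  proof -
    let ?u = "\<lambda>v. x $ inv_into UNIV b v"
    have inv_b: "inv_into UNIV b (b j) = j" for j
      using b by (simp add: bij_betw_def)
    have "(\<Sum>v\<in>B. ?u v *s v) = (\<Sum>j\<in>UNIV. ?u (b j) *s b j)"
      by (rule sum.reindex_bij_betw[OF b, symmetric])
    then have "(\<Sum>v\<in>B. ?u v *s v) = 0"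
      using that by (simp add: inv_b S_apply)
    then have "?u v = 0" if "v \<in> B" for v
      using vec.independentD[OF B(2) \<open>finite B\<close> subset_refl, of ?u] that by blast
    then have "x $ j = 0" for j
      using b inv_b[of j] by (metis bij_betwE iso_tuple_UNIV_I)
    then show ?thesis by (simp add: vec_eq_iff)
  qed
  then obtain T where T: "T ** S = mat 1"
    by (metis matrix_left_invertible_ker)
  define f where "f = (\<lambda>i. \<chi> j. cnj (S $ i $ j))"
  have "(\<chi> i j. cnj (T $ i $ j)) ** (\<chi> i. f i) = mat 1"
  proof -
    have "(\<Sum>k\<in>UNIV. cnj (T $ i $ k) * cnj (S $ k $ j)) = cnj ((T ** S) $ i $ j)" for i j
      by (simp add: matrix_matrix_mult_def)
    then show ?thesis
      by (simp add: T) (simp add: f_def matrix_matrix_mult_def mat_def vec_eq_iff T)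
  qed
  then have "vec.span (rows (\<chi> i. f i)) = UNIV"
    using matrix_left_invertible_span_rows_gen by blast
  moreover have "rows (\<chi> i. f i) = range f"
    by (auto simp: rows_def row_def)
  ultimately have "is_frame f" by (simp add: is_frame_def)
  moreover have "S = (\<chi> i j. cnj (f i $ j))"
    by (simp add: f_def vec_eq_iff)
  ultimately show "\<exists>S :: complex^'n^'m. is_frame_matrix S \<and> V = range ((*v) S)"
    using range_S unfolding is_frame_matrix_def by blast
qed

end

theory Submission
  imports Defs "HOL-Library.Function_Algebras"
begin

text \<open>
  Write \<open>z = S \<psi>\<^sub>0\<close> and \<open>a = |z|\<close>. Two facts combine.

  The orbit of \<open>z\<close> is isolated as soon as the range of \<open>S\<close> is separating at \<open>z\<close>: the only vectors
  \<open>h\<close> of the range with \<open>Re (cnj z\<^sub>i h\<^sub>i) = 0\<close> for all \<open>i\<close> are the real multiples of \<open>\<i> z\<close>, which is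
  the direction tangent to the orbit. Let \<open>z + h\<close> be a fixed point. The vector
  \<open>P\<^sub>a (z + h) - (z + h)\<close> is orthogonal to the range, in particular to \<open>h\<close>. Expanding this one
  scalar equation entry by entry shows that the defect \<open>|z + h| - |z|\<close> has size \<open>O(\<parallel>h\<parallel>\<^sup>2)\<close>, and
  therefore so has \<open>Re (cnj z\<^sub>i h\<^sub>i)\<close> (lemma \<open>fixed_point_estimate\<close>). Rotating the fixed point by a
  phase makes the inner product of \<open>z\<close> and \<open>h\<close> real; on such \<open>h\<close> separation makes the real-linear
  map \<open>h \<mapsto> (Re (cnj z\<^sub>i h\<^sub>i))\<^sub>i\<close> injective, so its size is at least a constant times \<open>\<parallel>h\<parallel>\<close>. Hence
  \<open>h = 0\<close> when \<open>h\<close> is small (lemma \<open>separating_imp_isolated\<close>).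

  A generic subspace is separating at all its nowhere vanishing vectors. In the chart of subspaces
  that are the range of a matrix \<open>A\<close> containing the identity in \<open>N\<close> chosen rows, failure of
  separation yields \<open>\<psi>\<close>, \<open>u\<close> with \<open>u\<^sub>k = \<i> r\<^sub>k \<psi>\<^sub>k\<close>, the real numbers \<open>r\<^sub>k\<close> not all equal, and
  \<open>\<Sum>\<^sub>k A\<^sub>i\<^sub>k \<psi>\<^sub>k (r\<^sub>k - \<rho>\<^sub>i) = 0\<close> with a real \<open>\<rho>\<^sub>i\<close> for each of the other \<open>M - N\<close> rows. Rescaling \<open>\<psi>\<close> and
  shifting \<open>r\<close> normalizes one entry of each, so \<open>\<psi>\<close> and \<open>r\<close> cost \<open>3 (N - 1)\<close> real parameters; each
  row costs one for \<open>\<rho>\<^sub>i\<close> and \<open>2 (N - 1)\<close> for its entries, one of which the equation determines.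
  Since \<open>M - N \<ge> 3 N - 2\<close>, the total \<open>3 (N - 1) + (M - N) (2 N - 1)\<close> is smaller than the number
  \<open>2 N (M - N)\<close> of real coordinates of the chart (lemma \<open>bad_matrix_parametrized\<close>).

  A set parametrized rationally by fewer parameters than it has coordinates lies in the zero set of
  a nonzero polynomial, by comparing dimensions: the polynomials of degree at most \<open>k\<close> in each of
  \<open>p\<close> coordinates form a space of dimension \<open>(k + 1)\<^sup>p\<close>, while their pullbacks lie in a space whose
  dimension grows with a smaller power of \<open>k\<close> (lemma \<open>fewer_parameters_dependent\<close>). Cramer's rule
  expresses the chart coordinates by minors of the orthogonal projector, which turns the polynomial
  into one on the Grassmannian; the subspaces where it is nonzero form the required open set.
\<close>

section \<open>Isolation of the phase orbit under separation\<close>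

definition hinner :: "complex^'m::finite \<Rightarrow> complex^'m \<Rightarrow> complex" where
  "hinner x y = (\<Sum>i\<in>UNIV. cnj (x $ i) * y $ i)"

lemma hinner_simps:
  "hinner x (y + z) = hinner x y + hinner x z"
  "hinner x (y - z) = hinner x y - hinner x z"
  "hinner x (c *s y) = c * hinner x y"
  "hinner (c *s x) y = cnj c * hinner x y"
  by (simp_all add: hinner_def algebra_simps sum.distrib sum_subtractf sum_distrib_left)

lemma hinner_self: "hinner x x = of_real ((norm x)\<^sup>2)"
proof -
  have "cnj (x $ i) * x $ i = of_real ((cmod (x $ i))\<^sup>2)" for i
    by (metis complex_norm_square mult.commute)
  then have "hinner x x = of_real (\<Sum>i\<in>UNIV. (cmod (x $ i))\<^sup>2)"
    by (simp add: hinner_def)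
  then show ?thesis by (simp add: norm_vec_def L2_set_def sum_nonneg)
qed

lemma hinner_hermitian:
  assumes "ctranspose P = P"
  shows "hinner (P *v x) y = hinner x (P *v y)"
proof -
  have P: "cnj (P $ i $ j) = P $ j $ i" for i j
    using arg_cong[OF assms, of "\<lambda>A. A $ j $ i"] by (simp add: ctranspose_def)
  show ?thesis
    by (simp add: hinner_def matrix_vector_mult_def sum_distrib_left sum_distrib_right P ac_simps)
       (rule sum.swap)
qed

lemma phase_correction_fixes_range:
  assumes "is_frame_matrix S" "v \<in> range ((*v) S)"
  shows "phase_correction S *v v = v"
proof -
  have P: "is_orthogonal_projector (phase_correction S) (range ((*v) S))"
    by (rule orthogonal_projector_range_frame(1)[OF assms(1)])
  then obtain w where "v = phase_correction S *v w"
    using assms(2) by (auto simp: is_orthogonal_projector_def)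
  then show ?thesis
    using P by (simp add: is_orthogonal_projector_def matrix_vector_mul_assoc)
qed

text \<open>
  At a fixed point the projection sends \<open>P\<^sub>a \<zeta>\<close> to \<open>\<zeta>\<close>, so the residual of the amplitude step is
  orthogonal to the range. The isolation argument uses the fixed point equation through this.
\<close>

lemma AP_fixed_point_orthogonal:
  assumes "is_frame_matrix S" "\<zeta> \<in> AP_fixed_points S a" "v \<in> range ((*v) S)"
  shows "hinner v (amplitude_correction a \<zeta> - \<zeta>) = 0"
proof -
  let ?P = "phase_correction S"
  have "ctranspose ?P = ?P"
    using orthogonal_projector_range_frame(1)[OF assms(1)] by (simp add: is_orthogonal_projector_def)
  then have "hinner (?P *v v) (amplitude_correction a \<zeta> - \<zeta>)
      = hinner v (?P *v amplitude_correction a \<zeta> - ?P *v \<zeta>)"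
    by (simp add: hinner_hermitian matrix_vector_mult_diff_distrib)
  moreover have "?P *v v = v" "?P *v \<zeta> = \<zeta>"
    using assms by (auto simp: AP_fixed_points_def intro: phase_correction_fixes_range)
  ultimately show ?thesis
    using assms(2) by (simp add: AP_fixed_points_def hinner_def)
qed

lemma amplitude_correction_phase:
  assumes "cmod \<omega> = 1" "\<And>i. z $ i \<noteq> 0"
  shows "amplitude_correction a (\<omega> *s z) = \<omega> *s amplitude_correction a z"
  using assms by (auto simp: amplitude_correction_def vec_eq_iff norm_mult)

lemma amplitude_correction_modulus:
  assumes "\<And>i. z $ i \<noteq> 0"
  shows "amplitude_correction (modulus z) z = z"
  using assms by (simp add: amplitude_correction_def modulus_def vec_eq_iff)

lemma phase_orbit_iff: "\<zeta> \<in> phase_orbit z \<longleftrightarrow> (\<exists>\<omega>. cmod \<omega> = 1 \<and> \<zeta> = \<omega> *s z)"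
proof
  assume "\<zeta> \<in> phase_orbit z"
  then show "\<exists>\<omega>. cmod \<omega> = 1 \<and> \<zeta> = \<omega> *s z"
    unfolding phase_orbit_def using norm_exp_i_times by blast
next
  assume "\<exists>\<omega>. cmod \<omega> = 1 \<and> \<zeta> = \<omega> *s z"
  then obtain \<omega> where \<omega>: "cmod \<omega> = 1" "\<zeta> = \<omega> *s z" by blast
  then have "exp (\<i> * of_real (Arg2pi \<omega>)) = \<omega>" using complex_norm_eq_1_exp by blast
  then show "\<zeta> \<in> phase_orbit z"
    unfolding phase_orbit_def using \<omega>(2) Arg2pi[of \<omega>]
    by (auto intro!: exI[of _ "Arg2pi \<omega>"])
qed

lemma AP_fixed_points_phase:
  assumes "cmod \<omega> = 1" "\<And>i. \<zeta> $ i \<noteq> 0" "\<zeta> \<in> AP_fixed_points S a"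
  shows "\<omega> *s \<zeta> \<in> AP_fixed_points S a"
proof -
  obtain u where u: "\<zeta> = S *v u" using assms(3) by (auto simp: AP_fixed_points_def)
  have "\<omega> *s \<zeta> = S *v (\<omega> *s u)" by (simp add: u vec.scale)
  then have "\<omega> *s \<zeta> \<in> range ((*v) S)" by simp
  then show ?thesis
    using assms by (auto simp: AP_fixed_points_def amplitude_correction_phase vec.scale)
qed

text \<open>
  One entry of the pairing of \<open>h\<close> with the residual. The residual is a real multiple of \<open>z + h\<close>, and
  \<open>2 Re (cnj h (z + h))\<close> is \<open>|z + h|\<^sup>2 - |z|\<^sup>2 + |h|\<^sup>2\<close>; so the pairing has a part quadratic in the
  modulus defect \<open>d\<close> with a definite sign, and a part that is linear in \<open>d\<close> but of second order in
  \<open>h\<close>.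
\<close>

lemma amplitude_error_identity:
  fixes z h :: complex
  assumes "z + h \<noteq> 0"
  defines "d \<equiv> cmod (z + h) - cmod z"
  shows "Re (cnj h * (of_real (cmod z) * (z + h) / of_real (cmod (z + h)) - (z + h)))
    = - ((d\<^sup>2 * (cmod (z + h) + cmod z) + d * (cmod h)\<^sup>2) / (2 * cmod (z + h)))"
proof -
  define w where "w = z + h"
  define r where "r = cmod w"
  have r: "r \<noteq> 0" using assms(1) by (simp add: r_def w_def)
  have zz: "(cmod z)\<^sup>2 = r\<^sup>2 - 2 * Re (cnj h * w) + (cmod h)\<^sup>2"
    unfolding r_def w_def cmod_power2 by (simp add: power2_eq_square algebra_simps)
  have "Re (cnj h * (of_real (cmod z) * w / of_real r - w)) = (cmod z / r - 1) * Re (cnj h * w)"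
    by (simp add: algebra_simps add_divide_distrib)
  also have "\<dots> = - (((r - cmod z)\<^sup>2 * (r + cmod z) + (r - cmod z) * (cmod h)\<^sup>2) / (2 * r))"
  proof -
    have "2 * Re (cnj h * w) = r\<^sup>2 - (cmod z)\<^sup>2 + (cmod h)\<^sup>2" using zz by simp
    then have x: "Re (cnj h * w) = (r\<^sup>2 - (cmod z)\<^sup>2 + (cmod h)\<^sup>2) / 2" by simp
    show ?thesis unfolding x using r by (simp add: field_simps power2_eq_square)
  qed
  finally show ?thesis by (simp add: w_def r_def d_def)
qed

text \<open>
  Summing the identity over all entries to zero bounds the sum of the squared defects by a constant
  times \<open>\<parallel>h\<parallel>\<^sup>2\<close> times the sum of the absolute defects, so each defect is \<open>O(\<parallel>h\<parallel>\<^sup>2)\<close>. Since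
  \<open>2 Re (cnj z\<^sub>i h\<^sub>i)\<close> differs from the defect of \<open>|z\<^sub>i|\<^sup>2\<close> by \<open>|h\<^sub>i|\<^sup>2\<close>, it is of second order too,
  whereas for a general \<open>h\<close> it is of first order.
\<close>

lemma fixed_point_estimate:
  fixes z h :: "complex^'m::finite"
  assumes \<delta>: "0 < \<delta>" "\<And>i. \<delta> \<le> cmod (z $ i)" "norm h \<le> \<delta> / 2"
    and orth: "Re (hinner h (amplitude_correction (modulus z) (z + h) - (z + h))) = 0"
  shows "\<bar>Re (cnj (z $ i) * h $ i)\<bar> \<le> (4 * real CARD('m) * norm z / \<delta> + 1) * (norm h)\<^sup>2"
proof -
  define d :: "real^'m" where "d = (\<chi> i. cmod (z $ i + h $ i) - cmod (z $ i))"
  define w where "w i = cmod (z $ i + h $ i)" for i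
  have h_le: "cmod (h $ i) \<le> norm h" for i by (rule Finite_Cartesian_Product.norm_nth_le)
  have z_le: "cmod (z $ i) \<le> norm z" for i by (rule Finite_Cartesian_Product.norm_nth_le)
  have w_ge: "\<delta> / 2 \<le> w i" for i
    using norm_triangle_ineq2[of "z $ i" "- h $ i"] \<delta>(2)[of i] h_le[of i] \<delta>(3) by (simp add: w_def)
  then have w_pos: "0 < w i" for i using \<delta>(1) by (meson half_gt_zero less_le_trans)
  have w_le: "w i \<le> 2 * norm z" for i
    using norm_triangle_ineq[of "z $ i" "h $ i"] \<delta>(2)[of i] z_le[of i] h_le[of i] \<delta>(3) \<delta>(1)
    by (simp add: w_def)
  have "0 = (\<Sum>i\<in>UNIV. Re (cnj (h $ i) * (of_real (cmod (z $ i)) * (z $ i + h $ i)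
      / of_real (w i) - (z $ i + h $ i))))"
    using orth w_pos by (simp add: hinner_def amplitude_correction_def modulus_def w_def)
  also have "\<dots> = (\<Sum>i\<in>UNIV. - (((d $ i)\<^sup>2 * (w i + cmod (z $ i)) + d $ i * (cmod (h $ i))\<^sup>2) / (2 * w i)))"
    using w_pos unfolding w_def d_def by (intro sum.cong refl) (subst amplitude_error_identity, auto)
  finally have "(\<Sum>i\<in>UNIV. ((d $ i)\<^sup>2 * (w i + cmod (z $ i)) + d $ i * (cmod (h $ i))\<^sup>2) / (2 * w i)) = 0"
    by (simp add: sum_negf)
  moreover have "(d $ i)\<^sup>2 / 2 - \<bar>d $ i\<bar> * (norm h)\<^sup>2 / \<delta>
      \<le> ((d $ i)\<^sup>2 * (w i + cmod (z $ i)) + d $ i * (cmod (h $ i))\<^sup>2) / (2 * w i)" for i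
  proof -
    have "(d $ i)\<^sup>2 / 2 \<le> (d $ i)\<^sup>2 * (w i + cmod (z $ i)) / (2 * w i)"
      using w_pos[of i] by (simp add: field_simps)
    moreover have "- (\<bar>d $ i\<bar> * (norm h)\<^sup>2 / \<delta>) \<le> d $ i * (cmod (h $ i))\<^sup>2 / (2 * w i)"
    proof -
      have "\<bar>d $ i * (cmod (h $ i))\<^sup>2 / (2 * w i)\<bar> = \<bar>d $ i\<bar> * (cmod (h $ i))\<^sup>2 / (2 * w i)"
        using w_pos[of i] by (simp add: abs_mult)
      also have "\<dots> \<le> \<bar>d $ i\<bar> * (norm h)\<^sup>2 / \<delta>"
        using w_ge[of i] \<delta>(1) h_le[of i] by (intro frac_le mult_left_mono power_mono) auto
      finally show ?thesis by linarith
    qed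
    ultimately show ?thesis unfolding add_divide_distrib by linarith
  qed
  ultimately have "(\<Sum>i\<in>UNIV. (d $ i)\<^sup>2 / 2 - \<bar>d $ i\<bar> * (norm h)\<^sup>2 / \<delta>) \<le> 0"
    by (metis (no_types, lifting) sum_mono)
  then have "(\<Sum>i\<in>UNIV. (d $ i)\<^sup>2) \<le> 2 * (\<Sum>i\<in>UNIV. \<bar>d $ i\<bar>) * (norm h)\<^sup>2 / \<delta>"
    by (simp add: sum_subtractf mult_ac flip: sum_divide_distrib sum_distrib_right)
  moreover have "(\<Sum>i\<in>UNIV. (d $ i)\<^sup>2) = (norm d)\<^sup>2"
    by (simp add: norm_vec_def L2_set_def sum_nonneg)
  moreover have "(\<Sum>i\<in>UNIV. \<bar>d $ i\<bar>) \<le> real CARD('m) * norm d"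
    using sum_bounded_above[of UNIV "\<lambda>i. \<bar>d $ i\<bar>" "norm d"] by (simp add: component_le_norm_cart)
  ultimately have "(norm d)\<^sup>2 \<le> 2 * (real CARD('m) * norm d) * (norm h)\<^sup>2 / \<delta>"
    using \<delta>(1) by (smt (verit) divide_right_mono mult_left_mono mult_right_mono zero_le_power2)
  then have "norm d * norm d \<le> norm d * (2 * real CARD('m) * (norm h)\<^sup>2 / \<delta>)"
    by (simp add: power2_eq_square ac_simps)
  then have d_le: "norm d \<le> 2 * real CARD('m) * (norm h)\<^sup>2 / \<delta>"
    using \<delta>(1) by (cases "norm d = 0") (simp, metis mult_left_le_imp_le norm_ge_zero order_le_less)
  have "(w i)\<^sup>2 = (cmod (z $ i))\<^sup>2 + 2 * Re (cnj (z $ i) * h $ i) + (cmod (h $ i))\<^sup>2"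
    unfolding w_def cmod_power2 by (simp add: power2_eq_square algebra_simps)
  then have "2 * Re (cnj (z $ i) * h $ i) = d $ i * (w i + cmod (z $ i)) - (cmod (h $ i))\<^sup>2"
    by (simp add: d_def w_def power2_eq_square algebra_simps)
  then have "2 * \<bar>Re (cnj (z $ i) * h $ i)\<bar> \<le> \<bar>d $ i * (w i + cmod (z $ i))\<bar> + (cmod (h $ i))\<^sup>2"
    by (smt (verit) zero_le_power2)
  also have "\<bar>d $ i * (w i + cmod (z $ i))\<bar> = \<bar>d $ i\<bar> * (w i + cmod (z $ i))"
    using w_pos[of i] by (simp add: abs_mult)
  also have "\<dots> \<le> (2 * real CARD('m) * (norm h)\<^sup>2 / \<delta>) * (4 * norm z)"
    using component_le_norm_cart[of d i] d_le w_le[of i] z_le[of i] w_pos[of i] \<delta>(1)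
    by (intro mult_mono) auto
  finally have "2 * \<bar>Re (cnj (z $ i) * h $ i)\<bar>
      \<le> 2 * (4 * real CARD('m) * norm z / \<delta> * (norm h)\<^sup>2) + (cmod (h $ i))\<^sup>2"
    by (simp add: mult_ac)
  moreover have "(cmod (h $ i))\<^sup>2 \<le> (norm h)\<^sup>2" by (rule power_mono[OF h_le]) simp
  moreover have "0 \<le> (norm h)\<^sup>2" by simp
  ultimately show ?thesis unfolding distrib_right by linarith
qed

text \<open>
  The orbit gives one direction in which fixed points do occur. It is removed by a gauge choice: a
  point near the orbit is rotated so that its inner product with \<open>z\<close> is real, which cuts the range
  down to the real subspace \<open>W\<close> below, where separation becomes injectivity.
\<close>

lemma separating_imp_isolated:
  fixes S :: "complex^'n::finite^'m::finite"
  assumes S: "is_frame_matrix S" and nz: "\<And>i. (S *v \<psi>) $ i \<noteq> 0"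
    and sep: "\<And>u. (\<And>i. Re (cnj ((S *v \<psi>) $ i) * (S *v u) $ i) = 0) \<Longrightarrow>
      \<exists>t. S *v u = (\<i> * of_real t) *s (S *v \<psi>)"
  shows "\<exists>U. open U \<and> phase_orbit (S *v \<psi>) \<subseteq> U \<and>
    U \<inter> AP_fixed_points S (modulus (S *v \<psi>)) = phase_orbit (S *v \<psi>)"
proof -
  define z where "z = S *v \<psi>"
  have z: "z $ i \<noteq> 0" "z \<in> range ((*v) S)" for i using nz by (auto simp: z_def)
  then have "z \<noteq> 0" by (metis zero_index)
  define W where "W = {h \<in> range ((*v) S). Im (hinner z h) = 0}"
  define \<Lambda> :: "complex^'m \<Rightarrow> real^'m" where "\<Lambda> h = (\<chi> i. Re (cnj (z $ i) * h $ i))" for h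
  have range_S: "vec.subspace (range ((*v) S))" by (intro vec.subspace_image) auto
  have real_scale: "r *\<^sub>R x = of_real r *s x" for r and x :: "complex^'m"
    by (simp add: vec_eq_iff complex_eq_iff)
  have W: "subspace W"
    unfolding subspace_def W_def
    using range_S by (auto simp: real_scale hinner_simps intro: vec.subspace_0 vec.subspace_add vec.subspace_scale)
      (auto simp: hinner_def)
  have \<Lambda>: "bounded_linear \<Lambda>"
    by (rule linear_conv_bounded_linear[THEN iffD1], rule linearI)
       (auto simp: \<Lambda>_def vec_eq_iff algebra_simps)
  have inj: "h = 0" if h: "h \<in> W" "\<Lambda> h = 0" for h
  proof -
    obtain u where u: "h = S *v u" using h(1) unfolding W_def by blast
    have Im: "Im (hinner z h) = 0" using h(1) by (simp add: W_def)
    have "Re (cnj (z $ i) * h $ i) = 0" for i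
      using arg_cong[OF h(2), of "\<lambda>x. x $ i"] by (simp add: \<Lambda>_def)
    then obtain t where t: "h = (\<i> * of_real t) *s z" using sep[of u] by (auto simp: u z_def)
    then have "t * (norm z)\<^sup>2 = 0" using Im by (simp add: hinner_simps hinner_self)
    then show "h = 0" using \<open>z \<noteq> 0\<close> t by simp
  qed
  obtain e where e: "e > 0" "\<And>h. h \<in> W \<Longrightarrow> e * norm h \<le> norm (\<Lambda> h)"
    using injective_imp_isometric[OF closed_subspace[OF W] W \<Lambda>] inj by (metis mult.commute)
  define \<delta> where "\<delta> = Min (range (\<lambda>i. cmod (z $ i)))"
  have \<delta>: "0 < \<delta>" "\<delta> \<le> cmod (z $ i)" for i
    using z(1) by (auto simp: \<delta>_def)
  \<comment> \<open>The constant of the quadratic estimate, summed over the entries.\<close>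
  define C where "C = real CARD('m) * (4 * real CARD('m) * norm z / \<delta> + 1)"
  have "C > 0" using \<delta>(1) by (auto simp: C_def intro!: mult_pos_pos add_nonneg_pos)
  define \<epsilon> where "\<epsilon> = min (\<delta> / 2) (e / C)"
  have \<epsilon>: "\<epsilon> > 0" "\<epsilon> \<le> \<delta> / 2" "\<epsilon> \<le> e / C" using \<delta>(1) e(1) \<open>C > 0\<close> 
    unfolding \<epsilon>_def by (simp_all only: min_less_iff_conj min.cobounded1 min.cobounded2) simp_all
  define U where "U = (\<Union>\<zeta>\<in>phase_orbit z. ball \<zeta> \<epsilon>)"
  have "open U" by (auto simp: U_def)
  moreover have "phase_orbit z \<subseteq> U" using \<epsilon>(1) by (force simp: U_def)
  moreover have "phase_orbit z \<subseteq> AP_fixed_points S (modulus z)"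
  proof
    fix \<zeta> assume "\<zeta> \<in> phase_orbit z"
    then obtain \<omega> where \<omega>: "cmod \<omega> = 1" "\<zeta> = \<omega> *s z" by (auto simp: phase_orbit_iff)
    have "z \<in> AP_fixed_points S (modulus z)"
      using z S by (simp add: AP_fixed_points_def amplitude_correction_modulus phase_correction_fixes_range)
    then show "\<zeta> \<in> AP_fixed_points S (modulus z)"
      unfolding \<omega>(2) by (intro AP_fixed_points_phase \<omega>(1) z(1))
  qed
  moreover have "\<zeta> \<in> phase_orbit z" if \<zeta>: "\<zeta> \<in> U" "\<zeta> \<in> AP_fixed_points S (modulus z)" for \<zeta>
  proof -
    obtain \<theta> where \<theta>: "cmod \<theta> = 1" "norm (\<zeta> - \<theta> *s z) < \<epsilon>"
      using \<zeta>(1) by (auto simp: U_def phase_orbit_iff dist_norm norm_minus_commute)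
    \<comment> \<open>This phase minimizes the distance of \<open>\<omega> \<zeta>\<close> to \<open>z\<close>, so \<open>h\<close> stays as small as \<open>\<zeta> - \<theta> z\<close>.\<close>
    define p where "p = hinner z \<zeta>"
    define \<omega> where "\<omega> = (if p = 0 then 1 else cnj (sgn p))"
    have \<omega>: "cmod \<omega> = 1" "\<omega> * p = of_real (cmod p)"
    proof -
      show "cmod \<omega> = 1" by (simp add: \<omega>_def norm_sgn)
      have "cnj p * p = of_real (cmod p) * of_real (cmod p)"
        by (metis complex_norm_square mult.commute power2_eq_square of_real_power)
      then show "\<omega> * p = of_real (cmod p)"
        by (auto simp: \<omega>_def sgn_eq field_simps)
    qed
    define h where "h = \<omega> *s \<zeta> - z"
    have norm_diff: "(norm (x - y))\<^sup>2 = (norm x)\<^sup>2 + (norm y)\<^sup>2 - 2 * Re (hinner y x)" for x y :: "complex^'m"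
    proof -
      have "Re (hinner y x) = y \<bullet> x" by (simp add: hinner_def inner_vec_def inner_complex_def)
      then show ?thesis by (simp add: power2_norm_eq_inner inner_diff inner_commute)
    qed
    have norm_phase: "norm (c *s x) = norm x" if "cmod c = 1" for c and x :: "complex^'m"
      using that by (simp add: norm_vec_def norm_mult)
    have "(norm h)\<^sup>2 = (norm \<zeta>)\<^sup>2 + (norm z)\<^sup>2 - 2 * cmod p"
      by (simp add: h_def norm_diff norm_phase \<omega> hinner_simps flip: p_def)
    also have "\<dots> \<le> (norm \<zeta>)\<^sup>2 + (norm z)\<^sup>2 - 2 * Re (cnj \<theta> * p)"
      using complex_Re_le_cmod[of "cnj \<theta> * p"] \<theta>(1) by (simp add: norm_mult)
    also have "\<dots> = (norm (\<zeta> - \<theta> *s z))\<^sup>2"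
      by (simp add: norm_diff norm_phase \<theta>(1) hinner_simps flip: p_def)
    finally have h_less: "norm h < \<epsilon>" using \<theta>(2) by (meson norm_ge_zero order_le_less_trans power2_le_imp_le)
    have nz_h: "(z + h) $ i \<noteq> 0" for i
    proof
      assume "(z + h) $ i = 0"
      then have "cmod (z $ i) = cmod (h $ i)" by (metis add_eq_0_iff norm_minus_cancel vector_add_component)
      then show False
        using Finite_Cartesian_Product.norm_nth_le[of h i] h_less \<epsilon>(2) \<delta>(2)[of i] \<delta>(1) by linarith
    qed
    have zh: "z + h = \<omega> *s \<zeta>" by (simp add: h_def)
    have "\<zeta> $ i \<noteq> 0" for i using nz_h[of i] unfolding zh by auto
    then have fix_zh: "z + h \<in> AP_fixed_points S (modulus z)"
      unfolding zh by (intro AP_fixed_points_phase \<omega>(1) \<zeta>(2))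
    then have "z + h \<in> range ((*v) S)" by (simp add: AP_fixed_points_def)
    then have h_range: "h \<in> range ((*v) S)"
      using vec.subspace_diff[OF range_S _ z(2), of "z + h"] by simp
    have "Im (hinner z h) = 0"
      by (simp add: h_def hinner_simps hinner_self \<omega>(2) flip: p_def)
    then have "h \<in> W" using h_range by (simp add: W_def)
    have "norm (\<Lambda> h) \<le> (\<Sum>i\<in>UNIV. \<bar>\<Lambda> h $ i\<bar>)" by (rule norm_le_l1_cart)
    also have "\<dots> \<le> (\<Sum>i\<in>(UNIV :: 'm set). (4 * real CARD('m) * norm z / \<delta> + 1) * (norm h)\<^sup>2)"
    proof (intro sum_mono)
      fix i
      have "\<bar>Re (cnj (z $ i) * h $ i)\<bar> \<le> (4 * real CARD('m) * norm z / \<delta> + 1) * (norm h)\<^sup>2"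
        using \<delta> h_less \<epsilon>(2) AP_fixed_point_orthogonal[OF S fix_zh h_range]
        by (intro fixed_point_estimate) auto
      then show "\<bar>\<Lambda> h $ i\<bar> \<le> (4 * real CARD('m) * norm z / \<delta> + 1) * (norm h)\<^sup>2"
        by (simp add: \<Lambda>_def)
    qed
    also have "\<dots> = C * norm h * norm h" by (simp add: C_def power2_eq_square)
    finally have "e * norm h \<le> C * norm h * norm h" using e(2)[OF \<open>h \<in> W\<close>] by linarith
    moreover have "C * norm h < C * \<epsilon>" "C * \<epsilon> \<le> e"
      using h_less \<epsilon>(3) \<open>C > 0\<close> by (simp_all add: field_simps)
    then have "C * norm h < e" by linarith
    ultimately have "h = 0" by (smt (verit) mult_right_mono mult_strict_right_mono zero_less_norm_iff)
    then have "\<omega> *s \<zeta> = z" using zh by simp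
    moreover have "\<omega> \<noteq> 0" using \<omega>(1) by auto
    ultimately have "\<zeta> = inverse \<omega> *s z" by (auto simp: vec_eq_iff field_simps)
    then show ?thesis using \<omega>(1) by (auto simp: phase_orbit_iff norm_inverse intro!: exI[of _ "inverse \<omega>"])
  qed
  ultimately show ?thesis unfolding z_def[symmetric] by blast
qed

section \<open>Polynomial images of spaces with few parameters\<close>

lemma sum_fun_apply: "(\<Sum>i\<in>I. f i) x = (\<Sum>i\<in>I. f i x)"
  for f :: "'i \<Rightarrow> 'a \<Rightarrow> 'b::comm_monoid_add"
  by (induction I rule: infinite_finite_induct) auto

text \<open>
  Real functions on an arbitrary set form a vector space under the pointwise operations; the
  dimension count below takes place in this space.
\<close>

interpretation fun_space: vector_space "\<lambda>c (f :: 'a \<Rightarrow> real) x. c * f x"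
  by unfold_locales (auto simp: fun_eq_iff algebra_simps)

text \<open>
  The coefficients are indexed by the family rather than by its set of values, so that a repetition
  in the family counts as a dependence.
\<close>

lemma dependent_family:
  fixes F :: "'i \<Rightarrow> 'a \<Rightarrow> real"
  assumes "finite I" "finite G" "F ` I \<subseteq> fun_space.span G" "card G < card I"
  obtains c where "\<exists>i\<in>I. c i \<noteq> 0" "\<And>x. (\<Sum>i\<in>I. c i * F i x) = 0"
proof (cases "inj_on F I")
  case True
  then have "\<not> fun_space.independent (F ` I)"
    using fun_space.independent_span_bound[OF assms(2) _ assms(3)] assms(4)
    by (auto simp: card_image)
  then obtain u where u: "\<exists>v\<in>F ` I. u v \<noteq> 0" "(\<Sum>v\<in>F ` I. (\<lambda>x. u v * v x)) = 0"
    using fun_space.dependent_finite[of "F ` I"] assms(1) by auto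
  show thesis
  proof
    show "\<exists>i\<in>I. u (F i) \<noteq> 0" using u(1) by auto
    show "(\<Sum>i\<in>I. u (F i) * F i x) = 0" for x
      using fun_cong[OF u(2), of x] True by (simp add: sum.reindex sum_fun_apply)
  qed
next
  case False
  then obtain i j where ij: "i \<in> I" "j \<in> I" "i \<noteq> j" "F i = F j" by (auto simp: inj_on_def)
  define c where "c l = (if l = i then 1 else if l = j then - 1 else 0 :: real)" for l
  have "(\<Sum>l\<in>I. c l * F l x) = (\<Sum>l\<in>{i,j}. c l * F l x)" for x
    using assms(1) ij by (intro sum.mono_neutral_right) (auto simp: c_def)
  then show thesis using ij by (intro that[of c]) (auto simp: c_def)
qed

definition monomials :: "'t set \<Rightarrow> nat \<Rightarrow> (('t \<Rightarrow> real) \<Rightarrow> real) set" where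
  "monomials T d = (\<lambda>\<beta> x. \<Prod>t\<in>T. x t ^ \<beta> t) ` (T \<rightarrow>\<^sub>E {..d})"

text \<open>
  The polynomial functions in the variables \<open>T\<close> of degree at most \<open>d\<close> in each variable. Bounding the
  degree per variable makes the monomials a box of exponents, which is easy to count.
\<close>

definition poly_space :: "'t set \<Rightarrow> nat \<Rightarrow> (('t \<Rightarrow> real) \<Rightarrow> real) set" where
  "poly_space T d = fun_space.span (monomials T d)"

lemma finite_monomials: "finite T \<Longrightarrow> finite (monomials T d)"
  by (simp add: monomials_def finite_PiE)

lemma card_monomials: "finite T \<Longrightarrow> card (monomials T d) \<le> Suc d ^ card T"
  unfolding monomials_def
  by (rule order_trans[OF card_image_le]) (auto simp: card_PiE finite_PiE)

lemma monomialsI: "(\<And>t. t \<in> T \<Longrightarrow> \<beta> t \<le> d) \<Longrightarrow> (\<lambda>x. \<Prod>t\<in>T. x t ^ \<beta> t) \<in> monomials T d"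
  unfolding monomials_def by (rule image_eqI[of _ _ "restrict \<beta> T"]) (auto simp: fun_eq_iff)

lemma poly_space_mono:
  assumes "d \<le> e" "f \<in> poly_space T d"
  shows "f \<in> poly_space T e"
proof -
  have "T \<rightarrow>\<^sub>E {..d} \<subseteq> T \<rightarrow>\<^sub>E {..e}" using assms(1) by (intro PiE_mono) auto
  then have "monomials T d \<subseteq> monomials T e" unfolding monomials_def by (rule image_mono)
  then show ?thesis using assms(2) fun_space.span_mono unfolding poly_space_def by blast
qed

lemma poly_space_monomial:
  "(\<And>t. t \<in> T \<Longrightarrow> \<beta> t \<le> d) \<Longrightarrow> (\<lambda>x. \<Prod>t\<in>T. x t ^ \<beta> t) \<in> poly_space T d"
  unfolding poly_space_def by (intro fun_space.span_base monomialsI)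

lemma poly_space_add: "f \<in> poly_space T d \<Longrightarrow> g \<in> poly_space T d \<Longrightarrow> (\<lambda>x. f x + g x) \<in> poly_space T d"
  using fun_space.span_add[of f _ g] by (simp add: poly_space_def plus_fun_def)

lemma poly_space_scale: "f \<in> poly_space T d \<Longrightarrow> (\<lambda>x. c * f x) \<in> poly_space T d"
  using fun_space.span_scale[of f] by (simp add: poly_space_def)

lemma poly_space_const: "(\<lambda>x. c) \<in> poly_space T d"
  using poly_space_scale[OF poly_space_monomial[of T "\<lambda>_. 0" d], of c] by simp

lemma poly_space_var: "finite T \<Longrightarrow> t \<in> T \<Longrightarrow> 1 \<le> d \<Longrightarrow> (\<lambda>x. x t) \<in> poly_space T d"
  using poly_space_monomial[of T "\<lambda>s. if s = t then 1 else 0" d]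
  by (simp add: if_distrib[of "\<lambda>n. _ ^ n"] cong: if_cong)

lemma poly_space_uminus: "f \<in> poly_space T d \<Longrightarrow> (\<lambda>x. - f x) \<in> poly_space T d"
  using poly_space_scale[of f T d "-1"] by simp

lemma poly_space_diff: "f \<in> poly_space T d \<Longrightarrow> g \<in> poly_space T d \<Longrightarrow> (\<lambda>x. f x - g x) \<in> poly_space T d"
  using poly_space_add[of f T d "\<lambda>x. - g x"] poly_space_uminus[of g] by simp

lemma poly_space_sum:
  "(\<And>i. i \<in> I \<Longrightarrow> f i \<in> poly_space T d) \<Longrightarrow> (\<lambda>x. \<Sum>i\<in>I. f i x) \<in> poly_space T d"
  by (induction I rule: infinite_finite_induct) (auto intro: poly_space_const poly_space_add)

text \<open>
  By linearity in each factor it is enough to multiply two monomials, where exponents add.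
\<close>

lemma poly_space_mult:
  assumes "f \<in> poly_space T d" "g \<in> poly_space T e"
  shows "(\<lambda>x. f x * g x) \<in> poly_space T (d + e)"
  using assms(1) unfolding poly_space_def[of T d]
proof (induction f rule: fun_space.span_induct_alt)
  case base
  show ?case using poly_space_const[of 0] by simp
next
  case (step c p f)
  then obtain \<beta> where \<beta>: "p = (\<lambda>x. \<Prod>t\<in>T. x t ^ \<beta> t)" "\<And>t. t \<in> T \<Longrightarrow> \<beta> t \<le> d"
    by (auto simp: monomials_def PiE_iff)
  have "(\<lambda>x. p x * g x) \<in> poly_space T (d + e)"
    using assms(2) unfolding poly_space_def[of T e]
  proof (induction g rule: fun_space.span_induct_alt)
    case base
    show ?case using poly_space_const[of 0] by simp
  next
    case (step c q g)
    then obtain \<gamma> where \<gamma>: "q = (\<lambda>x. \<Prod>t\<in>T. x t ^ \<gamma> t)" "\<And>t. t \<in> T \<Longrightarrow> \<gamma> t \<le> e"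
      by (auto simp: monomials_def PiE_iff)
    have "(\<lambda>x. \<Prod>t\<in>T. x t ^ (\<beta> t + \<gamma> t)) \<in> poly_space T (d + e)"
      using \<beta>(2) \<gamma>(2) by (intro poly_space_monomial add_mono)
    then have "(\<lambda>x. p x * q x) \<in> poly_space T (d + e)"
      by (simp add: \<beta>(1) \<gamma>(1) power_add prod.distrib)
    then show ?case
      using poly_space_add[OF poly_space_scale[of "\<lambda>x. p x * q x" T "d + e" c] step.IH]
      by (simp add: algebra_simps)
  qed
  then show ?case
    using poly_space_add[OF poly_space_scale[of "\<lambda>x. p x * g x" T "d + e" c] step.IH]
    by (simp add: algebra_simps)
qed

lemma poly_space_prod:
  assumes "finite I" "\<And>i. i \<in> I \<Longrightarrow> f i \<in> poly_space T d"
  shows "(\<lambda>x. \<Prod>i\<in>I. f i x) \<in> poly_space T (card I * d)"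
  using assms by (induction I) (auto intro: poly_space_const poly_space_mult)

text \<open>
  A polynomial of degree at most \<open>k\<close> in each variable, homogenized in every variable separately:
  \<open>N j / D j\<close> is the value of the coordinate \<open>j\<close>, given by numerator and denominator. It is expanded
  in the unnormalized Lagrange basis of the grid \<open>{0..k}\<^sup>J\<close> instead of in monomials, since the basis
  polynomial of a grid point vanishes at all other grid points, so that its coefficients can be
  read off from its values.
\<close>

definition grid_form :: "'j set \<Rightarrow> nat \<Rightarrow> (('j \<Rightarrow> nat) \<Rightarrow> real) \<Rightarrow> ('j \<Rightarrow> real) \<Rightarrow> ('j \<Rightarrow> real) \<Rightarrow> real" where
  "grid_form J k c N D =
     (\<Sum>\<alpha>\<in>J \<rightarrow>\<^sub>E {..k}. c \<alpha> * (\<Prod>j\<in>J. \<Prod>i\<in>{..k} - {\<alpha> j}. N j - real i * D j))"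

lemma grid_form_cong:
  assumes "\<And>j. j \<in> J \<Longrightarrow> N j = N' j" "\<And>j. j \<in> J \<Longrightarrow> D j = D' j"
  shows "grid_form J k c N D = grid_form J k c N' D'"
  using assms unfolding grid_form_def by (intro sum.cong prod.cong arg_cong2[of _ _ _ _ "(*)"]) auto

text \<open>
  Each basis polynomial has exactly \<open>k\<close> linear factors for each coordinate, so common factors of
  numerator and denominator come out. Clearing denominators therefore does not affect vanishing.
\<close>

lemma grid_form_scale:
  "grid_form J k c (\<lambda>j. s j * N j) (\<lambda>j. s j * D j) = (\<Prod>j\<in>J. s j ^ k) * grid_form J k c N D"
proof -
  have "(\<Prod>j\<in>J. \<Prod>i\<in>{..k} - {\<alpha> j}. s j * N j - real i * (s j * D j)) =
      (\<Prod>j\<in>J. s j ^ k) * (\<Prod>j\<in>J. \<Prod>i\<in>{..k} - {\<alpha> j}. N j - real i * D j)"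
    if "\<alpha> \<in> J \<rightarrow>\<^sub>E {..k}" for \<alpha>
  proof -
    have "(\<Prod>i\<in>{..k} - {\<alpha> j}. s j * N j - real i * (s j * D j)) =
        s j ^ k * (\<Prod>i\<in>{..k} - {\<alpha> j}. N j - real i * D j)" if "j \<in> J" for j
    proof -
      have "card ({..k} - {\<alpha> j}) = k"
        using \<open>\<alpha> \<in> J \<rightarrow>\<^sub>E {..k}\<close> that by (subst card_Diff_singleton) auto
      moreover have "s j * N j - real i * (s j * D j) = s j * (N j - real i * D j)" for i
        by (simp add: algebra_simps)
      ultimately show ?thesis by (simp add: prod.distrib)
    qed
    then show ?thesis by (simp add: prod.distrib)
  qed
  then show ?thesis
    unfolding grid_form_def sum_distrib_left
    by (intro sum.cong) (auto simp: algebra_simps)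
qed

lemma grid_form_at_grid_point:
  assumes "finite J" "\<beta> \<in> J \<rightarrow>\<^sub>E {..k}" "c \<beta> \<noteq> 0"
  shows "grid_form J k c (\<lambda>j. real (\<beta> j)) (\<lambda>j. 1) \<noteq> 0"
proof -
  define L where "L \<alpha> = (\<Prod>j\<in>J. \<Prod>i\<in>{..k} - {\<alpha> j}. real (\<beta> j) - real i * 1)" for \<alpha>
  have "L \<alpha> = 0" if \<alpha>: "\<alpha> \<in> J \<rightarrow>\<^sub>E {..k}" "\<alpha> \<noteq> \<beta>" for \<alpha>
  proof -
    obtain j where j: "j \<in> J" "\<alpha> j \<noteq> \<beta> j"
      using PiE_ext[OF \<alpha>(1) assms(2)] \<alpha>(2) by blast
    then have "\<beta> j \<in> {..k} - {\<alpha> j}" using assms(2) by (auto simp: PiE_iff)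
    then have "(\<Prod>i\<in>{..k} - {\<alpha> j}. real (\<beta> j) - real i * 1) = 0"
      by (intro prod_zero bexI[of _ "\<beta> j"]) auto
    then show ?thesis using j(1) assms(1) unfolding L_def by (intro prod_zero) blast+
  qed
  then have "grid_form J k c (\<lambda>j. real (\<beta> j)) (\<lambda>j. 1) = (\<Sum>\<alpha>\<in>{\<beta>}. c \<alpha> * L \<alpha>)"
    unfolding grid_form_def L_def[symmetric] using assms(1,2)
    by (intro sum.mono_neutral_right finite_PiE) auto
  moreover have "L \<beta> \<noteq> 0" using assms(1) by (simp add: L_def)
  ultimately show ?thesis using assms(3) by simp
qed

text \<open>
  The dimension count. The index \<open>\<pi>\<close> ranges over finitely many parametrizations, possibly in
  different variables, and one grid form has to vanish on all of them. The grid forms have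
  \<open>(k + 1) ^ card J\<close> coefficients. Pulled back along all parametrizations at once, they become
  functions of the pair of \<open>\<pi>\<close> and the parameters, which are polynomials of degree \<open>O(k)\<close> for each
  \<open>\<pi>\<close> and so lie in a space of dimension \<open>O(k ^ (card J - 1))\<close>.
\<close>

lemma fewer_parameters_dependent:
  fixes T :: "'c::finite \<Rightarrow> 't set" and N D :: "'c \<Rightarrow> 'j \<Rightarrow> ('t \<Rightarrow> real) \<Rightarrow> real"
  assumes J: "finite J" and T: "\<And>\<pi>. finite (T \<pi>)" "\<And>\<pi>. card (T \<pi>) < card J"
    and N: "\<And>\<pi> j. j \<in> J \<Longrightarrow> N \<pi> j \<in> poly_space (T \<pi>) d"
    and D: "\<And>\<pi> j. j \<in> J \<Longrightarrow> D \<pi> j \<in> poly_space (T \<pi>) d"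
  obtains k c where "\<exists>\<beta>\<in>J \<rightarrow>\<^sub>E {..k}. c \<beta> \<noteq> 0"
    "\<And>\<pi> x. grid_form J k c (\<lambda>j. N \<pi> j x) (\<lambda>j. D \<pi> j x) = 0"
proof -
  define m where "m = card J - 1"
  have m: "card J = Suc m" "card (T \<pi>) \<le> m" for \<pi> using T(2)[of \<pi>] by (auto simp: m_def)
  define q where "q = Suc (d * card J)"
  \<comment> \<open>With this \<open>k\<close>, the bound \<open>CARD('c) * (q * (k + 1)) ^ m\<close> for the dimension equals
    \<open>k * (k + 1) ^ m\<close>, just below the number \<open>(k + 1) ^ (m + 1)\<close> of coefficients.\<close>
  define k where "k = CARD('c) * q ^ m"
  define e where "e = card J * (k * d)"
  \<comment> \<open>Extension by zero from one parametrization to all of them.\<close>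
  define lift :: "'c \<Rightarrow> (('t \<Rightarrow> real) \<Rightarrow> real) \<Rightarrow> 'c \<times> ('t \<Rightarrow> real) \<Rightarrow> real" where
    "lift \<pi> f = (\<lambda>(\<rho>, x). if \<rho> = \<pi> then f x else 0)" for \<pi> f
  define G where "G = (\<Union>\<pi>. lift \<pi> ` monomials (T \<pi>) e)"
  have lift: "lift \<pi> f \<in> fun_space.span G" if "f \<in> poly_space (T \<pi>) e" for \<pi> f
    using that unfolding poly_space_def
  proof (induction f rule: fun_space.span_induct_alt)
    case base
    have "lift \<pi> 0 = 0" by (auto simp: lift_def fun_eq_iff)
    then show ?case by (metis fun_space.span_zero)
  next
    case (step c p f)
    have "lift \<pi> ((\<lambda>x. c * p x) + f) = (\<lambda>z. c * lift \<pi> p z) + lift \<pi> f"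
      by (auto simp: lift_def fun_eq_iff)
    moreover have "lift \<pi> p \<in> G" using step(1) by (auto simp: G_def)
    then have "(\<lambda>z. c * lift \<pi> p z) + lift \<pi> f \<in> fun_space.span G"
      by (intro fun_space.span_add fun_space.span_scale step.IH fun_space.span_base)
    ultimately show ?case by (metis (no_types))
  qed
  define F where "F \<alpha> = (\<lambda>(\<pi>, x). \<Prod>j\<in>J. \<Prod>i\<in>{..k} - {\<alpha> j}. N \<pi> j x - real i * D \<pi> j x)" for \<alpha>
  have "F \<alpha> \<in> fun_space.span G" if \<alpha>: "\<alpha> \<in> J \<rightarrow>\<^sub>E {..k}" for \<alpha>
  proof -
    have "(\<lambda>x. F \<alpha> (\<pi>, x)) \<in> poly_space (T \<pi>) e" for \<pi>
      unfolding F_def e_def prod.case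
    proof (intro poly_space_prod J)
      fix j assume j: "j \<in> J"
      have "card ({..k} - {\<alpha> j}) = k"
        using \<alpha> j by (subst card_Diff_singleton) auto
      moreover have "(\<lambda>x. \<Prod>i\<in>{..k} - {\<alpha> j}. N \<pi> j x - real i * D \<pi> j x)
          \<in> poly_space (T \<pi>) (card ({..k} - {\<alpha> j}) * d)"
        using N D j by (intro poly_space_prod poly_space_diff poly_space_scale) auto
      ultimately show "(\<lambda>x. \<Prod>i\<in>{..k} - {\<alpha> j}. N \<pi> j x - real i * D \<pi> j x) \<in> poly_space (T \<pi>) (k * d)"
        by simp
    qed
    then have "(\<Sum>\<pi>\<in>UNIV. lift \<pi> (\<lambda>x. F \<alpha> (\<pi>, x))) \<in> fun_space.span G"
      by (intro fun_space.span_sum lift)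
    moreover have "(\<Sum>\<pi>\<in>UNIV. lift \<pi> (\<lambda>x. F \<alpha> (\<pi>, x))) = F \<alpha>"
      by (auto simp: fun_eq_iff lift_def sum_fun_apply)
    ultimately show ?thesis by simp
  qed
  then have F_span: "F ` (J \<rightarrow>\<^sub>E {..k}) \<subseteq> fun_space.span G" by auto
  have G: "finite G" using T by (auto simp: G_def finite_monomials)
  have "card G < card (J \<rightarrow>\<^sub>E {..k})"
  proof -
    have "card G \<le> (\<Sum>\<pi>\<in>UNIV. card (lift \<pi> ` monomials (T \<pi>) e))"
      unfolding G_def by (rule card_UN_le) simp
    also have "\<dots> \<le> (\<Sum>\<pi>\<in>(UNIV :: 'c set). Suc e ^ m)"
    proof (rule sum_mono)
      fix \<pi>
      have "card (lift \<pi> ` monomials (T \<pi>) e) \<le> Suc e ^ card (T \<pi>)"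
        using T by (meson card_image_le card_monomials finite_monomials order_trans)
      also have "\<dots> \<le> Suc e ^ m" using m by (intro power_increasing) auto
      finally show "card (lift \<pi> ` monomials (T \<pi>) e) \<le> Suc e ^ m" .
    qed
    also have "\<dots> = CARD('c) * Suc e ^ m" by simp
    also have "\<dots> \<le> CARD('c) * (q * Suc k) ^ m"
      by (intro mult_left_mono power_mono) (auto simp: e_def q_def algebra_simps)
    also have "\<dots> = k * Suc k ^ m" by (simp only: k_def power_mult_distrib mult.assoc)
    also have "\<dots> < Suc k ^ card J" by (simp add: m)
    also have "\<dots> = card (J \<rightarrow>\<^sub>E {..k})" using J by (simp add: card_PiE)
    finally show ?thesis .
  qed
  then obtain c where c: "\<exists>\<alpha>\<in>J \<rightarrow>\<^sub>E {..k}. c \<alpha> \<noteq> 0" "\<And>z. (\<Sum>\<alpha>\<in>J \<rightarrow>\<^sub>E {..k}. c \<alpha> * F \<alpha> z) = 0"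
    using dependent_family[OF finite_PiE[OF J finite_atMost] G F_span] by blast
  show thesis
  proof (rule that[OF c(1)])
    show "grid_form J k c (\<lambda>j. N \<pi> j x) (\<lambda>j. D \<pi> j x) = 0" for \<pi> x
      using c(2)[of "(\<pi>, x)"] by (simp add: grid_form_def F_def)
  qed
qed

section \<open>Parametrization of the non-separating subspaces in a chart\<close>

definition complex_poly :: "'t set \<Rightarrow> nat \<Rightarrow> (('t \<Rightarrow> real) \<Rightarrow> complex) \<Rightarrow> bool" where
  "complex_poly T d f \<longleftrightarrow> (\<lambda>x. Re (f x)) \<in> poly_space T d \<and> (\<lambda>x. Im (f x)) \<in> poly_space T d"

lemma complex_poly_mult:
  "complex_poly T d f \<Longrightarrow> complex_poly T e g \<Longrightarrow> complex_poly T (d + e) (\<lambda>x. f x * g x)"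
  by (auto simp: complex_poly_def intro!: poly_space_diff poly_space_add poly_space_mult)

lemma complex_poly_of_real: "f \<in> poly_space T d \<Longrightarrow> complex_poly T d (\<lambda>x. of_real (f x))"
  by (simp add: complex_poly_def poly_space_const)

lemma complex_poly_uminus: "complex_poly T d f \<Longrightarrow> complex_poly T d (\<lambda>x. - f x)"
  by (simp add: complex_poly_def poly_space_uminus)

lemma complex_poly_sum:
  "(\<And>i. i \<in> I \<Longrightarrow> complex_poly T d (f i)) \<Longrightarrow> complex_poly T d (\<lambda>x. \<Sum>i\<in>I. f i x)"
  by (simp add: complex_poly_def poly_space_sum)

lemma complex_poly_Complex:
  "finite T \<Longrightarrow> s \<in> T \<Longrightarrow> t \<in> T \<Longrightarrow> complex_poly T 1 (\<lambda>x. Complex (x s) (x t))"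
  by (simp add: complex_poly_def poly_space_var)

lemma complex_poly_mono: "complex_poly T d f \<Longrightarrow> d \<le> e \<Longrightarrow> complex_poly T e f"
  by (auto simp: complex_poly_def intro: poly_space_mono)

definition part :: "bool \<Rightarrow> complex \<Rightarrow> real" where
  "part b z = (if b then Re z else Im z)"

lemma part_real_mult: "part b (of_real r * z) = r * part b z"
  by (simp add: part_def)

definition entry :: "complex^'n::finite^'m::finite \<Rightarrow> 'm \<times> 'n \<times> bool \<Rightarrow> real" where
  "entry A = (\<lambda>(i, k, b). part b (A $ i $ k))"

text \<open>
  The parameters of a non-separating matrix \<open>A\<close> with data \<open>\<psi>\<close>, \<open>r\<close>, \<open>\<rho>\<close> as in the introduction,
  normalized at a chosen index \<open>k0\<close>: \<open>Scale k\<close> is \<open>\<psi>\<^sub>k\<^sub>0 / \<psi>\<^sub>k\<close>, \<open>Ratio k\<close> is \<open>r\<^sub>k - r\<^sub>k\<^sub>0\<close>, \<open>Slope i\<close> is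
  \<open>\<rho>\<^sub>i - r\<^sub>k\<^sub>0\<close>, and \<open>Row i k\<close> is \<open>A\<^sub>i\<^sub>k \<psi>\<^sub>k / \<psi>\<^sub>k\<^sub>0\<close>. With the entries rescaled in this way the
  equation of each row becomes linear with real coefficients.
\<close>

datatype ('m, 'n) param = Scale 'n bool | Ratio 'n | Slope 'm | Row 'm 'n bool

text \<open>
  The parameters that are free when row \<open>i\<close> is solved for its entry at \<open>\<pi> i\<close>.
\<close>

definition params :: "'m set \<Rightarrow> 'n \<Rightarrow> ('m \<Rightarrow> 'n) \<Rightarrow> ('m, 'n) param set" where
  "params R k0 \<pi> = {t. case t of Scale k b \<Rightarrow> k \<noteq> k0 | Ratio k \<Rightarrow> k \<noteq> k0 | Slope i \<Rightarrow> i \<in> R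
     | Row i k b \<Rightarrow> i \<in> R \<and> k \<noteq> \<pi> i}"

lemma mem_params [simp]:
  "Scale k b \<in> params R k0 \<pi> \<longleftrightarrow> k \<noteq> k0"
  "Ratio k \<in> params R k0 \<pi> \<longleftrightarrow> k \<noteq> k0"
  "Slope i \<in> params R k0 \<pi> \<longleftrightarrow> i \<in> R"
  "Row i k b \<in> params R k0 \<pi> \<longleftrightarrow> i \<in> R \<and> k \<noteq> \<pi> i"
  by (simp_all add: params_def)

lemma params_eq:
  "params R k0 \<pi> = case_prod Scale ` ((- {k0}) \<times> UNIV) \<union> Ratio ` (- {k0}) \<union> Slope ` R \<union>
     (\<lambda>(i, k, b). Row i k b) ` (SIGMA i:R. (- {\<pi> i}) \<times> UNIV)"
proof (rule set_eqI)
  show "t \<in> params R k0 \<pi> \<longleftrightarrow> t \<in> case_prod Scale ` ((- {k0}) \<times> UNIV) \<union> Ratio ` (- {k0}) \<union> Slope ` R \<union>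
     (\<lambda>(i, k, b). Row i k b) ` (SIGMA i:R. (- {\<pi> i}) \<times> UNIV)" for t
    by (cases t) (auto simp: params_def image_iff)
qed

lemma finite_params: "finite (params R k0 \<pi>)" for R :: "'m::finite set" and k0 :: "'n::finite"
  by (simp add: params_eq)

lemma card_params:
  fixes R :: "'m::finite set" and k0 :: "'n::finite"
  shows "card (params R k0 \<pi>) \<le> 3 * (CARD('n) - 1) + card R * (2 * CARD('n) - 1)"
proof -
  define q where "q = CARD('n) - 1"
  have compl: "card (- {k}) = q" for k :: 'n
    by (simp add: q_def Compl_eq_Diff_UNIV card_Diff_singleton)
  have "card (params R k0 \<pi>) \<le> card (((- {k0}) \<times> (UNIV :: bool set))) + card (- {k0})
      + card R + card (SIGMA i:R. (- {\<pi> i}) \<times> (UNIV :: bool set))"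
    unfolding params_eq
    by (intro order_trans[OF card_Un_le] add_mono card_image_le) simp_all
  also have "card (((- {k0}) \<times> (UNIV :: bool set))) + card (- {k0})
      + card R + card (SIGMA i:R. (- {\<pi> i}) \<times> (UNIV :: bool set))
      = 3 * (CARD('n) - 1) + card R * (1 + 2 * q)"
    unfolding q_def[symmetric] by (simp add: card_cartesian_product compl algebra_simps)
  also have "1 + 2 * q = 2 * CARD('n) - 1"
    using zero_less_card_finite[where 'a='n] unfolding q_def by linarith
  finally show ?thesis .
qed

definition column_scale :: "'n \<Rightarrow> 'n \<Rightarrow> (('m, 'n) param \<Rightarrow> real) \<Rightarrow> complex" where
  "column_scale k0 k x = (if k = k0 then 1 else Complex (x (Scale k True)) (x (Scale k False)))"

definition ratio :: "'n \<Rightarrow> 'n \<Rightarrow> (('m, 'n) param \<Rightarrow> real) \<Rightarrow> real" where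
  "ratio k0 k x = (if k = k0 then 0 else x (Ratio k))"

definition row_entry :: "'m \<Rightarrow> 'n \<Rightarrow> (('m, 'n) param \<Rightarrow> real) \<Rightarrow> complex" where
  "row_entry i k x = Complex (x (Row i k True)) (x (Row i k False))"

text \<open>
  The entries of \<open>A\<close> as rational functions of the free parameters: the entry of row \<open>i\<close> at \<open>\<pi> i\<close> is
  the solution of the row equation, with the coefficient \<open>r - \<rho>\<close> of that entry as its denominator.
\<close>

definition row_numer :: "'n \<Rightarrow> ('m \<Rightarrow> 'n) \<Rightarrow> 'm \<times> 'n::finite \<times> bool \<Rightarrow> (('m, 'n) param \<Rightarrow> real) \<Rightarrow> real" where
  "row_numer k0 \<pi> = (\<lambda>(i, k, b) x. part b (column_scale k0 k x *
     (if k = \<pi> i then - (\<Sum>l\<in>- {k}. of_real (ratio k0 l x - x (Slope i)) * row_entry i l x)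
      else row_entry i k x)))"

definition row_denom :: "'n \<Rightarrow> ('m \<Rightarrow> 'n) \<Rightarrow> 'm \<times> 'n \<times> bool \<Rightarrow> (('m, 'n) param \<Rightarrow> real) \<Rightarrow> real" where
  "row_denom k0 \<pi> = (\<lambda>(i, k, b) x. if k = \<pi> i then ratio k0 k x - x (Slope i) else 1)"

lemma ratio_minus_slope_poly:
  fixes R :: "'m::finite set" and k0 :: "'n::finite"
  assumes "i \<in> R"
  shows "(\<lambda>x. ratio k0 k x - x (Slope i)) \<in> poly_space (params R k0 \<pi>) 1"
proof -
  have "ratio k0 k \<in> poly_space (params R k0 \<pi>) 1"
    by (cases "k = k0") (auto simp: ratio_def[abs_def] poly_space_const finite_params intro!: poly_space_var)
  then show ?thesis using assms by (intro poly_space_diff poly_space_var) (auto simp: finite_params)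
qed

lemma row_numer_poly:
  fixes R :: "'m::finite set" and k0 :: "'n::finite"
  assumes "j \<in> R \<times> UNIV \<times> UNIV"
  shows "row_numer k0 \<pi> j \<in> poly_space (params R k0 \<pi>) 3"
proof -
  obtain i k b where j: "j = (i, k, b)" "i \<in> R" using assms by auto
  let ?T = "params R k0 \<pi>"
  have row: "complex_poly ?T 1 (row_entry i l)" if "l \<noteq> \<pi> i" for l
    unfolding row_entry_def[abs_def] using that j(2) by (intro complex_poly_Complex) (auto simp: finite_params)
  have "complex_poly ?T 1 (column_scale k0 k)"
  proof (cases "k = k0")
    case True
    then show ?thesis using complex_poly_of_real[OF poly_space_const[of 1]] by (simp add: column_scale_def[abs_def])
  next
    case False
    then show ?thesis unfolding column_scale_def[abs_def]
      by (simp add: complex_poly_Complex finite_params del: One_nat_def)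
  qed
  moreover have "complex_poly ?T 2
      (\<lambda>x. if k = \<pi> i then - (\<Sum>l\<in>- {k}. of_real (ratio k0 l x - x (Slope i)) * row_entry i l x)
      else row_entry i k x)"
  proof (cases "k = \<pi> i")
    case True
    have "complex_poly ?T (1 + 1)
        (\<lambda>x. - (\<Sum>l\<in>- {k}. of_real (ratio k0 l x - x (Slope i)) * row_entry i l x))"
      using True j(2)
      by (intro complex_poly_uminus complex_poly_sum complex_poly_mult complex_poly_of_real
          ratio_minus_slope_poly row) auto
    then show ?thesis using True by (simp add: numeral_2_eq_2)
  next
    case False
    then show ?thesis using complex_poly_mono[OF row, of k 2] by simp
  qed
  ultimately have "complex_poly ?T (1 + 2) (\<lambda>x. column_scale k0 k x *
      (if k = \<pi> i then - (\<Sum>l\<in>- {k}. of_real (ratio k0 l x - x (Slope i)) * row_entry i l x)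
      else row_entry i k x))"
    by (rule complex_poly_mult)
  then show ?thesis
    by (cases b) (auto simp: j(1) row_numer_def part_def complex_poly_def numeral_3_eq_3 simp del: times_complex.sel)
qed

lemma row_denom_poly:
  fixes R :: "'m::finite set" and k0 :: "'n::finite"
  assumes "j \<in> R \<times> UNIV \<times> UNIV"
  shows "row_denom k0 \<pi> j \<in> poly_space (params R k0 \<pi>) 3"
proof -
  obtain i k b where j: "j = (i, k, b)" "i \<in> R" using assms by auto
  show ?thesis
    using poly_space_mono[OF _ ratio_minus_slope_poly[OF j(2), of k0 k \<pi>], of 3]
    by (cases "k = \<pi> i") (auto simp: j(1) row_denom_def poly_space_const)
qed

text \<open>
  A row equation can be solved for any entry whose coefficient \<open>r\<^sub>k - \<rho>\<^sub>i\<close> is nonzero, and one of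
  \<open>k0\<close>, \<open>k1\<close> is such an index because \<open>r\<close> takes different values there.
\<close>

lemma bad_matrix_parametrized:
  fixes A :: "complex^'n::finite^'m::finite"
  assumes \<psi>: "\<And>k. \<psi> $ k \<noteq> 0" and u: "\<And>k. u $ k = \<i> * of_real (r k) * \<psi> $ k"
    and \<rho>: "\<And>i. i \<in> R \<Longrightarrow> (A *v u) $ i = \<i> * of_real (\<rho> i) * (A *v \<psi>) $ i"
    and r: "r k1 \<noteq> r k0"
  shows "\<exists>\<pi> x. \<forall>j\<in>R \<times> UNIV \<times> UNIV. row_denom k0 \<pi> j x \<noteq> 0 \<and> row_numer k0 \<pi> j x = row_denom k0 \<pi> j x * entry A j"
proof -
  define \<pi> where "\<pi> i = (if r k0 \<noteq> \<rho> i then k0 else k1)" for i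
  have \<pi>: "r (\<pi> i) \<noteq> \<rho> i" for i using r by (auto simp: \<pi>_def)
  define B where "B i k = A $ i $ k * \<psi> $ k / \<psi> $ k0" for i k
  define x where "x t = (case t of
      Scale k b \<Rightarrow> part b (\<psi> $ k0 / \<psi> $ k) | Ratio k \<Rightarrow> r k - r k0 | Slope i \<Rightarrow> \<rho> i - r k0
      | Row i k b \<Rightarrow> part b (B i k))" for t
  have x: "column_scale k0 k x = \<psi> $ k0 / \<psi> $ k" "ratio k0 k x = r k - r k0" "x (Slope i) = \<rho> i - r k0"
    "row_entry i k x = B i k" for i k
    using \<psi>[of k0] by (auto simp: column_scale_def ratio_def row_entry_def x_def part_def)
  have A: "column_scale k0 k x * B i k = A $ i $ k" for i k
    using \<psi>[of k0] \<psi>[of k] by (simp add: x B_def)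
  have B0: "(\<Sum>l\<in>UNIV. of_real (r l - \<rho> i) * B i l) = 0" if "i \<in> R" for i
  proof -
    have "\<i> * (\<Sum>l\<in>UNIV. of_real (r l - \<rho> i) * (A $ i $ l * \<psi> $ l)) = (A *v u) $ i - \<i> * of_real (\<rho> i) * (A *v \<psi>) $ i"
      by (simp add: matrix_vector_mult_def u sum_distrib_left algebra_simps flip: sum_subtractf)
    also have "\<dots> = 0" using \<rho>[OF that] by simp
    finally have "(\<Sum>l\<in>UNIV. of_real (r l - \<rho> i) * (A $ i $ l * \<psi> $ l)) / \<psi> $ k0 = 0" by simp
    then show ?thesis by (simp add: B_def sum_divide_distrib)
  qed
  show ?thesis
  proof (intro exI ballI conjI)
    fix j :: "'m \<times> 'n \<times> bool" assume "j \<in> R \<times> UNIV \<times> UNIV"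
    then obtain i k b where j: "j = (i, k, b)" "i \<in> R" by auto
    show "row_denom k0 \<pi> j x \<noteq> 0" using \<pi>[of i] by (auto simp: j(1) row_denom_def x)
    show "row_numer k0 \<pi> j x = row_denom k0 \<pi> j x * entry A j"
    proof (cases "k = \<pi> i")
      case True
      have "(\<Sum>l\<in>- {k}. of_real (r l - \<rho> i) * B i l) = - (of_real (r k - \<rho> i) * B i k)"
        using B0[OF j(2)] by (simp add: sum.remove[of UNIV k] Compl_eq_Diff_UNIV add_eq_0_iff)
      then have "column_scale k0 k x * - (\<Sum>l\<in>- {k}. of_real (r l - \<rho> i) * B i l) = of_real (r k - \<rho> i) * A $ i $ k"
        by (simp add: A[of k i, symmetric] mult_ac)
      then have "part b (column_scale k0 k x * - (\<Sum>l\<in>- {k}. of_real (r l - \<rho> i) * B i l))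
          = (r k - \<rho> i) * part b (A $ i $ k)"
        by (simp only: part_real_mult)
      then show ?thesis using True by (simp add: j(1) row_numer_def row_denom_def entry_def x(2-4))
    next
      case False
      then show ?thesis by (simp add: j(1) row_numer_def row_denom_def entry_def x(4) A)
    qed
  qed
qed

text \<open>
  The grid point \<open>\<beta>\<close> with nonzero coefficient is part of the conclusion because the grid form does
  not vanish there. This is where the number of rows enters: each row has one coordinate more than
  it has parameters of its own, so \<open>3 N - 2\<close> rows outweigh the \<open>3 (N - 1)\<close> parameters that all rows
  share.
\<close>

lemma generic_grid_form:
  fixes R :: "'m::finite set"
  assumes "3 * CARD('n::finite) - 2 \<le> card R"
  obtains K c \<beta> where "\<beta> \<in> (R \<times> UNIV \<times> UNIV) \<rightarrow>\<^sub>E {..K}" "c \<beta> \<noteq> 0"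
    "\<And>(A :: complex^'n^'m) \<psi> u r \<rho> k k'.
       \<lbrakk>\<And>k. \<psi> $ k \<noteq> 0; \<And>k. u $ k = \<i> * of_real (r k) * \<psi> $ k;
        \<And>i. i \<in> R \<Longrightarrow> (A *v u) $ i = \<i> * of_real (\<rho> i) * (A *v \<psi>) $ i;
        grid_form (R \<times> UNIV \<times> UNIV) K c (entry A) (\<lambda>_. 1) \<noteq> 0\<rbrakk> \<Longrightarrow> r k = r k'"
proof -
  let ?J = "R \<times> (UNIV :: 'n set) \<times> (UNIV :: bool set)"
  define k0 :: 'n where "k0 = undefined"
  have card: "card (params R k0 \<pi>) < card ?J" for \<pi> :: "'m \<Rightarrow> 'n"
  proof -
    have "card ?J = card R * (2 * CARD('n) - 1) + card R"
    proof -
      define q where "q = 2 * CARD('n) - 1"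
      have "CARD('n) * 2 = Suc q"
        using zero_less_card_finite[where 'a='n] unfolding q_def by linarith
      then show ?thesis unfolding q_def[symmetric] by (simp add: card_cartesian_product)
    qed
    moreover have "3 * (CARD('n) - 1) < card R"
      using assms zero_less_card_finite[where 'a='n] by linarith
    ultimately show ?thesis using card_params[of R k0 \<pi>] by linarith
  qed
  obtain K c where c: "\<exists>\<beta>\<in>?J \<rightarrow>\<^sub>E {..K}. c \<beta> \<noteq> 0"
    "\<And>\<pi> x. grid_form ?J K c (\<lambda>j. row_numer k0 \<pi> j x) (\<lambda>j. row_denom k0 \<pi> j x) = 0"
    by (rule fewer_parameters_dependent[of ?J "params R k0" "row_numer k0" 3 "row_denom k0",
        OF finite finite_params card row_numer_poly row_denom_poly]) (assumption | rule that)+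
  obtain \<beta> where \<beta>: "\<beta> \<in> ?J \<rightarrow>\<^sub>E {..K}" "c \<beta> \<noteq> 0" using c(1) by blast
  have const: "r k = r k0"
    if *: "\<And>k. \<psi> $ k \<noteq> 0" "\<And>k. u $ k = \<i> * of_real (r k) * \<psi> $ k"
        "\<And>i. i \<in> R \<Longrightarrow> (A *v u) $ i = \<i> * of_real (\<rho> i) * (A *v \<psi>) $ i"
        "grid_form ?J K c (entry A) (\<lambda>_. 1) \<noteq> 0"
    for A :: "complex^'n^'m" and \<psi> u r \<rho> k
  proof (rule ccontr)
    assume "r k \<noteq> r k0"
    then obtain \<pi> x where x: "\<And>j. j \<in> ?J \<Longrightarrow> row_denom k0 \<pi> j x \<noteq> 0"
      "\<And>j. j \<in> ?J \<Longrightarrow> row_numer k0 \<pi> j x = row_denom k0 \<pi> j x * entry A j"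
      using bad_matrix_parametrized[of \<psi> u r R A \<rho> k k0, OF *(1-3)] by meson
    have "0 = grid_form ?J K c (\<lambda>j. row_numer k0 \<pi> j x) (\<lambda>j. row_denom k0 \<pi> j x)" by (rule c(2)[symmetric])
    also have "\<dots> = grid_form ?J K c (\<lambda>j. row_denom k0 \<pi> j x * entry A j) (\<lambda>j. row_denom k0 \<pi> j x * 1)"
      using x(2) by (intro grid_form_cong) auto
    also have "\<dots> = (\<Prod>j\<in>?J. row_denom k0 \<pi> j x ^ K) * grid_form ?J K c (entry A) (\<lambda>_. 1)"
      by (rule grid_form_scale)
    finally have "(\<Prod>j\<in>?J. row_denom k0 \<pi> j x ^ K) = 0" using *(4) by simp
    then obtain j where "j \<in> ?J" "row_denom k0 \<pi> j x ^ K = 0" by (meson finite prod_zero_iff)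
    then show False using x(1)[of j] power_not_zero by blast
  qed
  show thesis
  proof (rule that[where c = c, OF \<beta>])
    fix A :: "complex^'n^'m" and \<psi> u r \<rho> k k'
    assume *: "\<And>k. \<psi> $ k \<noteq> 0" "\<And>k. u $ k = \<i> * of_real (r k) * \<psi> $ k"
      "\<And>i. i \<in> R \<Longrightarrow> (A *v u) $ i = \<i> * of_real (\<rho> i) * (A *v \<psi>) $ i"
      "grid_form ?J K c (entry A) (\<lambda>_. 1) \<noteq> 0"
    show "r k = r k'" using const[OF *, of k] const[OF *, of k'] by simp
  qed
qed

section \<open>The chart in terms of orthogonal projectors\<close>

definition complex_polynomial_function :: "('a::real_normed_vector \<Rightarrow> complex) \<Rightarrow> bool" where
  "complex_polynomial_function f \<longleftrightarrow>
     real_polynomial_function (\<lambda>x. Re (f x)) \<and> real_polynomial_function (\<lambda>x. Im (f x))"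

lemma complex_polynomial_function_const: "complex_polynomial_function (\<lambda>x. c)"
  by (auto simp: complex_polynomial_function_def)

lemma complex_polynomial_function_cnj:
  "complex_polynomial_function f \<Longrightarrow> complex_polynomial_function (\<lambda>x. cnj (f x))"
  by (auto simp: complex_polynomial_function_def)

lemma complex_polynomial_function_mult:
  "complex_polynomial_function f \<Longrightarrow> complex_polynomial_function g \<Longrightarrow>
   complex_polynomial_function (\<lambda>x. f x * g x)"
  by (auto simp: complex_polynomial_function_def)

lemma complex_polynomial_function_sum:
  "finite I \<Longrightarrow> (\<And>i. i \<in> I \<Longrightarrow> complex_polynomial_function (f i)) \<Longrightarrow>
   complex_polynomial_function (\<lambda>x. \<Sum>i\<in>I. f i x)"
  by (auto simp: complex_polynomial_function_def intro!: real_polynomial_function_sum)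

lemma complex_polynomial_function_prod:
  "finite I \<Longrightarrow> (\<And>i. i \<in> I \<Longrightarrow> complex_polynomial_function (f i)) \<Longrightarrow>
   complex_polynomial_function (\<lambda>x. \<Prod>i\<in>I. f i x)"
  by (induction I rule: finite_induct)
     (auto intro: complex_polynomial_function_const complex_polynomial_function_mult)

text \<open>
  By the Leibniz formula.
\<close>

lemma complex_polynomial_function_det:
  assumes "\<And>i j. complex_polynomial_function (\<lambda>x. M x $ i $ j)"
  shows "complex_polynomial_function (\<lambda>x. det (M x))"
  unfolding det_def using assms
  by (intro complex_polynomial_function_sum complex_polynomial_function_mult
      complex_polynomial_function_prod complex_polynomial_function_const) (auto simp: finite_permutations)

lemma complex_polynomial_function_entry:
  "complex_polynomial_function (\<lambda>P :: complex^'n::finite^'m::finite. P $ i $ j)"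
  unfolding complex_polynomial_function_def
  by (intro conjI real_polynomial_function.intros(1))
     (auto intro!: linear_conv_bounded_linear[THEN iffD1] linearI)

definition block :: "('n::finite \<Rightarrow> 'm::finite) \<Rightarrow> complex^'m^'m \<Rightarrow> complex^'n^'n" where
  "block e P = (\<chi> k l. P $ e k $ e l)"

definition minor :: "('n::finite \<Rightarrow> 'm::finite) \<Rightarrow> complex^'m^'m \<Rightarrow> 'm \<Rightarrow> 'n \<Rightarrow> complex" where
  "minor e P i k = det (\<chi> p q. if q = k then P $ i $ e p else P $ e q $ e p)"

text \<open>
  By Cramer's rule an entry of \<open>A\<close> is the quotient of \<open>minor\<close> by the determinant of \<open>block\<close>.
  Multiplying both by the conjugate of that determinant gives a real denominator, so that real and
  imaginary parts of the entries become quotients of real polynomials in \<open>P\<close>.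
\<close>

definition chart_numer :: "('n::finite \<Rightarrow> 'm::finite) \<Rightarrow> complex^'m^'m \<Rightarrow> 'm \<times> 'n \<times> bool \<Rightarrow> real" where
  "chart_numer e P = (\<lambda>(i, k, b). part b (minor e P i k * cnj (det (block e P))))"

definition chart_denom :: "('n::finite \<Rightarrow> 'm::finite) \<Rightarrow> complex^'m^'m \<Rightarrow> real" where
  "chart_denom e P = (cmod (det (block e P)))\<^sup>2"

lemma block_poly: "complex_polynomial_function (\<lambda>P. det (block e P))"
  by (rule complex_polynomial_function_det) (simp add: block_def complex_polynomial_function_entry)

lemma chart_numer_poly: "real_polynomial_function (\<lambda>P. chart_numer e P j)"
proof -
  obtain i k b where j: "j = (i, k, b)" by (cases j)
  have "complex_polynomial_function (\<lambda>P. minor e P i k)"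
    unfolding minor_def
  proof (rule complex_polynomial_function_det)
    show "complex_polynomial_function
        (\<lambda>P. (\<chi> p q. if q = k then P $ i $ e p else P $ e q $ e p) $ p $ q)" for p q
      by (cases "q = k") (simp_all add: complex_polynomial_function_entry)
  qed
  then have "complex_polynomial_function (\<lambda>P. minor e P i k * cnj (det (block e P)))"
    by (intro complex_polynomial_function_mult complex_polynomial_function_cnj block_poly)
  then show ?thesis
    by (cases b) (simp_all only: j chart_numer_def part_def complex_polynomial_function_def prod.case if_True if_False)
qed

lemma chart_denom_poly: "real_polynomial_function (chart_denom e)"
  using block_poly[of e] unfolding chart_denom_def[abs_def] cmod_power2 complex_polynomial_function_def
  by auto

definition normalized :: "('n \<Rightarrow> 'm) \<Rightarrow> complex^'n::finite^'m::finite \<Rightarrow> bool" where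
  "normalized e A \<longleftrightarrow> (\<forall>k. A $ e k = axis k 1)"

lemma normalized_component:
  assumes "normalized e A" shows "(A *v y) $ e k = y $ k"
proof -
  have "A $ e k $ l = (if l = k then 1 else 0)" for l
    using assms by (simp add: normalized_def axis_def)
  then have "(A *v y) $ e k = (\<Sum>l\<in>UNIV. (if l = k then 1 else 0) * y $ l)"
    by (simp add: matrix_vector_mult_def)
  also have "\<dots> = (\<Sum>l\<in>UNIV. if l = k then y $ l else 0)" by (intro sum.cong) auto
  finally show ?thesis by simp
qed

text \<open>
  Column \<open>e l\<close> of \<open>P\<close> lies in the range of \<open>A\<close>, and its coefficients with respect to the columns of
  \<open>A\<close> can be read off in the rows \<open>e k\<close>, where \<open>A\<close> is the identity. So every row of \<open>A\<close> solves a
  linear system whose matrix is the transposed block.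
\<close>

lemma chart_numer_eq:
  assumes A: "normalized e A" and range: "range ((*v) P) = range ((*v) A)"
  shows "chart_numer e P j = chart_denom e P * entry A j"
proof -
  obtain i k b where j: "j = (i, k, b)" by (cases j)
  have col: "(P *v axis l 1) $ i = P $ i $ l" for i l
    by (simp add: matrix_vector_mult_def axis_def if_distrib cong: if_cong)
  have P: "P $ i $ e l = (\<Sum>k\<in>UNIV. P $ e k $ e l * A $ i $ k)" for i l
  proof -
    have "P *v axis (e l) 1 \<in> range ((*v) A)" using range by blast
    then obtain y where y: "P *v axis (e l) 1 = A *v y" by blast
    have "y $ k = P $ e k $ e l" for k
      using arg_cong[OF y, of "\<lambda>v. v $ e k"] by (simp add: normalized_component[OF A] col)
    moreover have "P $ i $ e l = (A *v y) $ i" using col[of "e l" i] y by simp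
    ultimately show ?thesis by (simp add: matrix_vector_mult_def mult.commute)
  qed
  have solve: "(transpose (block e P) *v (A $ i)) $ p = P $ i $ e p" for p
    by (simp add: matrix_vector_mult_def Finite_Cartesian_Product.transpose_def block_def P[of i p])
  have "minor e P i k = det (\<chi> p q. if q = k then (transpose (block e P) *v (A $ i)) $ p
      else transpose (block e P) $ p $ q)"
    unfolding minor_def solve
    by (simp add: Finite_Cartesian_Product.transpose_def block_def cong: if_cong)
  also have "\<dots> = A $ i $ k * det (block e P)" by (simp only: cramer_lemma det_transpose)
  finally have "minor e P i k = A $ i $ k * det (block e P)" .
  then have "minor e P i k * cnj (det (block e P)) = of_real (chart_denom e P) * A $ i $ k"
    unfolding chart_denom_def complex_norm_square of_real_power
    by (metis complex_norm_square mult.assoc mult.commute of_real_power)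
  then show ?thesis by (simp only: j chart_numer_def entry_def prod.case part_real_mult)
qed

lemma block_mult:
  fixes S :: "complex^'n::finite^'m::finite"
  shows "block e (S ** B) = (\<chi> k j. S $ e k $ j) ** (\<chi> j l. B $ j $ e l)"
  by (simp add: block_def matrix_matrix_mult_def vec_eq_iff)

text \<open>
  The block of the projector factors through the square matrix \<open>T\<close> of the rows \<open>e k\<close> of \<open>S\<close>. If its
  determinant is nonzero, then \<open>T\<close> is invertible and can be split off from \<open>S\<close>.
\<close>

lemma chart_factorization:
  fixes S :: "complex^'n::finite^'m::finite" and e :: "'n \<Rightarrow> 'm"
  assumes "chart_denom e (phase_correction S) \<noteq> 0"
  obtains A T where "normalized e A" "S = A ** T" "invertible T"
proof -
  define T :: "complex^'n^'n" where "T = (\<chi> k j. S $ e k $ j)"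
  have "block e (phase_correction S) =
      T ** (\<chi> j l. (matrix_inv (ctranspose S ** S) ** ctranspose S) $ j $ e l)"
    unfolding phase_correction_def T_def matrix_mul_assoc[symmetric] by (rule block_mult)
  then have "det T \<noteq> 0" using assms by (auto simp: chart_denom_def det_mul)
  then have "invertible T" by (simp add: invertible_det_nz)
  then obtain Q where Q: "T ** Q = mat 1" "Q ** T = mat 1" by (auto simp: invertible_def)
  show thesis
  proof
    show "invertible T" by fact
    show "S = (S ** Q) ** T" by (simp add: Q flip: matrix_mul_assoc)
    have "(S ** Q) $ e k = (T ** Q) $ k" for k
      by (simp add: T_def matrix_matrix_mult_def vec_eq_iff)
    then show "normalized e (S ** Q)"
      by (simp add: normalized_def Q) (simp add: mat_def axis_def vec_eq_iff)
  qed
qed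

lemma normalized_frame:
  assumes "normalized e A"
  shows "is_frame_matrix A"
proof -
  define f where "f i = (\<chi> j. cnj (A $ i $ j))" for i
  have "axis k 1 = f (e k)" for k
    using assms by (simp add: normalized_def f_def axis_def vec_eq_iff)
  then have "cart_basis \<subseteq> range f" by (auto simp: cart_basis_def)
  then have "vec.span (range f) = UNIV"
    using vec.span_mono[of cart_basis "range f"] by (simp add: top.extremum_unique)
  then show ?thesis
    unfolding is_frame_matrix_def is_frame_def
    by (intro exI[of _ f]) (simp add: f_def vec_eq_iff)
qed

text \<open>
  For a normalized matrix the block of the projector is the inverse of the Gram matrix.
\<close>

lemma normalized_chart_denom:
  assumes "normalized e A"
  shows "chart_denom e (phase_correction A) \<noteq> 0"
proof -
  let ?G = "ctranspose A ** A"
  have rows: "(\<chi> k j. A $ e k $ j) = mat 1"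
    using assms by (simp add: normalized_def mat_def axis_def vec_eq_iff)
  have cols: "(\<chi> j l. (matrix_inv ?G ** ctranspose A) $ j $ e l) = matrix_inv ?G"
  proof -
    have A: "A $ e l $ j = (if j = l then 1 else 0)" for l j
      using assms by (simp add: normalized_def axis_def)
    have "(matrix_inv ?G ** ctranspose A) $ j $ e l = matrix_inv ?G $ j $ l" for j l
    proof -
      have "(matrix_inv ?G ** ctranspose A) $ j $ e l = (\<Sum>k\<in>UNIV. if k = l then matrix_inv ?G $ j $ k else 0)"
        unfolding matrix_matrix_mult_def ctranspose_def by (simp add: A if_distrib cong: if_cong)
      then show ?thesis by simp
    qed
    then show ?thesis by (simp add: vec_eq_iff)
  qed
  have "block e (phase_correction A) = matrix_inv ?G"
    unfolding phase_correction_def matrix_mul_assoc[symmetric] block_mult rows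
    by (simp only: matrix_mul_assoc cols matrix_mul_lid)
  moreover have "invertible ?G" by (rule invertible_gram[OF normalized_frame[OF assms]])
  then have "?G ** matrix_inv ?G = mat 1"
    unfolding invertible_def matrix_inv_def by (metis (mono_tags, lifting) someI_ex)
  then have "det ?G * det (matrix_inv ?G) = 1" by (metis det_I det_mul)
  ultimately show ?thesis by (auto simp: chart_denom_def)
qed

text \<open>
  Where \<open>A \<psi>\<close> does not vanish, \<open>Re (cnj (A \<psi>) (A u)) = 0\<close> says that \<open>A u\<close> is a multiple of \<open>A \<psi>\<close> by a
  number \<open>\<i> \<rho>\<^sub>i\<close> with \<open>\<rho>\<^sub>i\<close> real. On the rows \<open>e k\<close> this concerns the entries of \<open>\<psi>\<close> and \<open>u\<close> themselves,
  so if \<open>\<rho>\<close> is constant on them, then \<open>u\<close> is the corresponding multiple of \<open>\<psi>\<close>.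
\<close>

lemma normalized_separating:
  fixes A :: "complex^'n::finite^'m::finite" and e :: "'n \<Rightarrow> 'm"
  assumes A: "normalized e A"
    and const: "\<And>\<psi> u r \<rho> k k'. \<lbrakk>\<And>k. \<psi> $ k \<noteq> 0; \<And>k. u $ k = \<i> * of_real (r k) * \<psi> $ k;
        \<And>i. i \<in> - range e \<Longrightarrow> (A *v u) $ i = \<i> * of_real (\<rho> i) * (A *v \<psi>) $ i\<rbrakk> \<Longrightarrow> r k = r k'"
    and nz: "\<And>i. (A *v \<psi>) $ i \<noteq> 0"
    and real: "\<And>i. Re (cnj ((A *v \<psi>) $ i) * (A *v u) $ i) = 0"
  shows "\<exists>t. A *v u = (\<i> * of_real t) *s (A *v \<psi>)"
proof -
  define \<rho> where "\<rho> i = Im ((A *v u) $ i / (A *v \<psi>) $ i)" for i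
  have \<rho>: "(A *v u) $ i = \<i> * of_real (\<rho> i) * (A *v \<psi>) $ i" for i
  proof -
    have "Re ((A *v u) $ i / (A *v \<psi>) $ i) = 0"
      using real[of i] by (simp add: Re_divide mult.commute)
    then have "(A *v u) $ i / (A *v \<psi>) $ i = \<i> * of_real (\<rho> i)"
      by (simp add: complex_eq_iff \<rho>_def)
    then show ?thesis using nz[of i] by (simp add: field_simps)
  qed
  have \<psi>: "\<psi> $ k \<noteq> 0" for k using nz[of "e k"] by (simp add: normalized_component[OF A])
  have u: "u $ k = \<i> * of_real (\<rho> (e k)) * \<psi> $ k" for k
    using \<rho>[of "e k"] by (simp add: normalized_component[OF A])
  have "\<rho> (e k) = \<rho> (e undefined)" for k
    by (rule const[of \<psi> u "\<lambda>k. \<rho> (e k)" \<rho>, OF \<psi> u \<rho>])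
  then have "u = (\<i> * of_real (\<rho> (e undefined))) *s \<psi>"
    using u by (simp add: vec_eq_iff)
  then show ?thesis by (metis vec.scale)
qed


section \<open>The generic subspace\<close>

theorem theorem3p16:
  assumes "CARD('m::finite) \<ge> 4 * CARD('n::finite) - 2"
  shows "\<exists>\<U> :: (complex^'m) set set. zariski_open CARD('n) \<U> \<and> \<U> \<noteq> {} \<and>
    (\<forall>S :: complex^'n^'m. is_frame_matrix S \<longrightarrow> range ((*v) S) \<in> \<U> \<longrightarrow>
      (\<forall>\<psi>\<^sub>0 :: complex^'n. (\<forall>i. modulus (S *v \<psi>\<^sub>0) $ i \<noteq> 0) \<longrightarrow>
        (\<exists>U. open U \<and> phase_orbit (S *v \<psi>\<^sub>0) \<subseteq> U \<and>
          U \<inter> AP_fixed_points S (modulus (S *v \<psi>\<^sub>0)) = phase_orbit (S *v \<psi>\<^sub>0))))"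
proof -
  have n_pos: "0 < CARD('n)" by simp
  then have "CARD('n) \<le> CARD('m)" using assms by linarith
  then obtain e :: "'n \<Rightarrow> 'm" where e: "inj e"
    using card_le_inj[of "UNIV :: 'n set" "UNIV :: 'm set"] by auto
  define R where "R = - range e"
  let ?J = "R \<times> (UNIV :: 'n set) \<times> (UNIV :: bool set)"
  have "card R = CARD('m) - CARD('n)"
    using e by (simp add: R_def Compl_eq_Diff_UNIV card_Diff_subset card_image)
  then have "3 * CARD('n) - 2 \<le> card R" using assms n_pos by linarith
  from generic_grid_form[OF this] obtain K c \<beta> where \<beta>: "\<beta> \<in> ?J \<rightarrow>\<^sub>E {..K}" "c \<beta> \<noteq> 0"
    and const: "\<And>(A :: complex^'n^'m) \<psi> u r \<rho> k k'.
       \<lbrakk>\<And>k. \<psi> $ k \<noteq> 0; \<And>k. u $ k = \<i> * of_real (r k) * \<psi> $ k;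
        \<And>i. i \<in> R \<Longrightarrow> (A *v u) $ i = \<i> * of_real (\<rho> i) * (A *v \<psi>) $ i;
        grid_form ?J K c (entry A) (\<lambda>_. 1) \<noteq> 0\<rbrakk> \<Longrightarrow> r k = r k'" by metis
  \<comment> \<open>The extra factor restricts the open set to the domain of the chart.\<close>
  define p where "p P = chart_denom e P * grid_form ?J K c (chart_numer e P) (\<lambda>_. chart_denom e P)" for P
  have p_poly: "real_polynomial_function p"
    unfolding p_def[abs_def] grid_form_def
    by (intro real_polynomial_function.intros(4) chart_denom_poly real_polynomial_function_sum
        real_polynomial_function_prod real_polynomial_function_diff real_polynomial_function.intros(2)
        chart_numer_poly) (auto intro: finite_PiE)
  have p_eq: "p P = chart_denom e P * (\<Prod>j\<in>?J. chart_denom e P ^ K) * grid_form ?J K c (entry A) (\<lambda>_. 1)"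
    if "normalized e A" "range ((*v) P) = range ((*v) A)" for P and A :: "complex^'n^'m"
  proof -
    have "chart_numer e P = (\<lambda>j. chart_denom e P * entry A j)"
      using chart_numer_eq[OF that] by blast
    then show ?thesis
      using grid_form_scale[of ?J K c "\<lambda>_. chart_denom e P" "entry A" "\<lambda>_. 1"]
      unfolding p_def by (simp only: mult_1_right mult.assoc)
  qed
  define \<U> :: "(complex^'m) set set" where
    "\<U> = {V \<in> Grassmannian CARD('n). p (orthogonal_projector V) \<noteq> 0}"
  have "zariski_open CARD('n) \<U>"
    unfolding zariski_open_def zariski_closed_def \<U>_def using p_poly
    by (auto intro!: exI[of _ "{p}"])
  moreover have "\<U> \<noteq> {}"
  proof -
    \<comment> \<open>The matrix whose chart coordinates are the grid point \<open>\<beta>\<close>.\<close>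
    define A :: "complex^'n^'m" where "A = (\<chi> i. if i \<in> range e then axis (inv e i) 1
      else (\<chi> k. Complex (real (\<beta> (i, k, True))) (real (\<beta> (i, k, False)))))"
    have A: "normalized e A" using e by (simp add: normalized_def A_def)
    then have S: "is_frame_matrix A" by (rule normalized_frame)
    have "entry A j = real (\<beta> j)" if "j \<in> ?J" for j
      using that by (auto simp: entry_def A_def R_def part_def)
    then have "grid_form ?J K c (entry A) (\<lambda>_. 1) = grid_form ?J K c (\<lambda>j. real (\<beta> j)) (\<lambda>_. 1)"
      by (intro grid_form_cong) auto
    also have "\<dots> \<noteq> 0" by (rule grid_form_at_grid_point[where c = c, OF _ \<beta>]) simp
    finally have "p (phase_correction A) \<noteq> 0"
      using p_eq[OF A, of "phase_correction A"] orthogonal_projector_range_frame(1)[OF S]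
        normalized_chart_denom[OF A]
      by (simp add: is_orthogonal_projector_def)
    then have "range ((*v) A) \<in> \<U>"
      using S Grassmannian_iff_range_frame[where 'n='n]
      by (auto simp: \<U>_def orthogonal_projector_range_frame(2)[OF S])
    then show ?thesis by blast
  qed
  moreover have "\<exists>U. open U \<and> phase_orbit (S *v \<psi>) \<subseteq> U \<and>
      U \<inter> AP_fixed_points S (modulus (S *v \<psi>)) = phase_orbit (S *v \<psi>)"
    if S: "is_frame_matrix S" "range ((*v) S) \<in> \<U>" and nz: "\<forall>i. modulus (S *v \<psi>) $ i \<noteq> 0"
    for S :: "complex^'n^'m" and \<psi>
  proof (rule separating_imp_isolated[OF S(1)])
    show nz': "(S *v \<psi>) $ i \<noteq> 0" for i using nz by (simp add: modulus_def)
    fix u assume u: "\<And>i. Re (cnj ((S *v \<psi>) $ i) * (S *v u) $ i) = 0"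
    let ?P = "phase_correction S"
    have p: "p ?P \<noteq> 0" using S(2) by (simp add: \<U>_def orthogonal_projector_range_frame(2)[OF S(1)])
    then have "chart_denom e ?P \<noteq> 0" by (auto simp: p_def)
    then obtain A T where A: "normalized e A" "S = A ** T" "invertible T"
      by (rule chart_factorization)
    obtain Q where Q: "T ** Q = mat 1" using A(3) by (auto simp: invertible_def)
    have "range ((*v) S) = range ((*v) A)"
    proof
      show "range ((*v) S) \<subseteq> range ((*v) A)" by (auto simp: A(2) simp flip: matrix_vector_mul_assoc)
      have "A *v x = S *v (Q *v x)" for x
        by (simp add: A(2) Q matrix_vector_mul_assoc flip: matrix_mul_assoc)
      then show "range ((*v) A) \<subseteq> range ((*v) S)" by auto
    qed
    then have "range ((*v) ?P) = range ((*v) A)"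
      using orthogonal_projector_range_frame(1)[OF S(1)] by (simp add: is_orthogonal_projector_def)
    then have gf: "grid_form ?J K c (entry A) (\<lambda>_. 1) \<noteq> 0" using p p_eq[OF A(1)] by auto
    have S_apply: "S *v x = A *v (T *v x)" for x by (simp add: A(2) matrix_vector_mul_assoc)
    show "\<exists>t. S *v u = (\<i> * of_real t) *s (S *v \<psi>)"
      unfolding S_apply
    proof (rule normalized_separating[OF A(1)])
      show "(A *v (T *v \<psi>)) $ i \<noteq> 0" "Re (cnj ((A *v (T *v \<psi>)) $ i) * (A *v (T *v u)) $ i) = 0" for i
        using nz' u unfolding S_apply by blast+
    next
      fix \<psi> u :: "complex^'n" and r \<rho> k k'
      assume "\<And>k. \<psi> $ k \<noteq> 0" "\<And>k. u $ k = \<i> * of_real (r k) * \<psi> $ k"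
        "\<And>i. i \<in> - range e \<Longrightarrow> (A *v u) $ i = \<i> * of_real (\<rho> i) * (A *v \<psi>) $ i"
      then show "r k = r k'" using const[of \<psi> u r A \<rho> k k'] gf unfolding R_def by blast
    qed
  qed
  ultimately show ?thesis by blast
qed

end
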